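(* Consider a 2DMBC with forward channel $P_{Y_f,Z_f|X_f}$ and backward channel $P_{Y_b,Z_b|X_b}$, and let the random variables $X_f,Y_f,Z_f$ and $X_b,Y_b,Z_b$ correspond to $P_{Y_f,Z_f|X_f}$ and $P_{Y_b,Z_b|X_b}$, respectively. The secret-key capacity of the 2DMBC is upper bounded as $$C^{2DMBC}_{sk}(P_{Y_f,Z_f|X_f},P_{Y_b,Z_b|X_b})\ \leq\ \max_{P_{X_f},P_{X_b}}\{\,I(X_f;Y_f|Z_f),\ I(X_b;Y_b|Z_b)\,\},$$ i.e. by the maximum, over all input distributions $P_{X_f}$ on $\mathcal X_f$ and $P_{X_b}$ on $\mathcal X_b$, of the larger of the two conditional mutual informations.
   Context: All alphabets are finite; logarithms are base 2; $H$ and $I$ denote Shannon entropy and (conditional) mutual information. Channels. A discrete memoryless broadcast channel (DMBC) $X\rightarrow(Y,Z)$ is a memoryless channel with input $X$ and outputs $Y,Z$, specified by a conditional distribution $P_{Y,Z|X}$. A 2DMBC is a pair of independent DMBCs: a forward DMBC $X_f\rightarrow(Y_f,Z_f)$ (input by Alice, $Y_f$ received by Bob, $Z_f$ received by the passive adversary Eve), specified by $P_{Y_f,Z_f|X_f}$ over finite sets $\mathcal X_f,\mathcal Y_f,\mathcal Z_f$, and a backward DMBC $X_b\rightarrow(Y_b,Z_b)$ (input by Bob, $Y_b$ received by Alice, $Z_b$ received by Eve), specified by $P_{Y_b,Z_b|X_b}$ over finite sets $\mathcal X_b,\mathcal Y_b,\mathcal Z_b$. SKE protocol. A secret key establishment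 (SKE) protocol in the 2DMBC setup consists of an arbitrary finite number of consecutive communication rounds; either party may initiate. In each round either Alice sends a sequence of symbols over the forward DMBC or Bob sends a sequence of symbols over the backward DMBC; the legitimate receiver of the round then computes the sequence to be sent in the next round. A sent sequence is a (possibly randomized) function of all sequences previously sent or received by the sender, the local randomness being independent of the other parties' views. The view of a party at the end of the protocol is the collection of all sequences it sent and/or received: $View_A$ for Alice (forward inputs and backward outputs $Y_b$), $View_B$ for Bob (backward inputs and forward outputs $Y_f$), $View_E$ for Eve (all outputs $Z_f$ and $Z_b$). At the end, one of Alice and Bob computes a key $S$ as a function of his/her view, and the other computes an estimate $\hat S$ of it as a function of his/her view. Let $n_f$ and $n_b$ be the total numbers of uses of the forward and backward channels in the protocol. For $R_{sk}\ge 0$ and $0\le\delta\le1$, the protocol is $(R_{sk},\delta)$-secure if $$\frac{H(S)}{n_f+n_b}>R_{sk}-\delta,\qquad \Pr(\hat S\ne S)<\delta,\qquad \frac{H(S|View_E)}{H(S)}>1-\delta .$$ The last condition is regarded as satisfied if $H(S)=0$. The secret-key capacity $C^{2DMBC}_{sk}(P_{Y_f,Z_f|X_f},P_{Y_b,Z_b|X_b})$ is the largest $R_{sk}\ge0$ such that for any arbitrarily small $\delta>0$ there exists an $(R_{sk},\delta)$-secure SKE protocol. *)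

theory Defs
  imports "HOL-Probability.Probability" "HOL-Real_Asymp.Real_Asymp"
begin

section \<open>Shannon information of random variables on a probability mass function\<close>

text \<open>
  These are the base-2 instances of the library notions. The reference measure is counting measure
  on the whole value type; the random variables below take values in countable types and have
  finite support, so the library integrals are the usual finite sums.
\<close>

definition entropy_pmf :: "'a pmf \<Rightarrow> ('a \<Rightarrow> 'b) \<Rightarrow> real" where
  "entropy_pmf p X = prob_space.entropy (measure_pmf p) 2 (count_space UNIV) X"

definition cond_entropy_pmf :: "'a pmf \<Rightarrow> ('a \<Rightarrow> 'b) \<Rightarrow> ('a \<Rightarrow> 'c) \<Rightarrow> real" where
  "cond_entropy_pmf p X Y =
     prob_space.conditional_entropy (measure_pmf p) 2 (count_space UNIV) (count_space UNIV) X Y"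

definition cond_mutual_information_pmf ::
    "'a pmf \<Rightarrow> ('a \<Rightarrow> 'b) \<Rightarrow> ('a \<Rightarrow> 'c) \<Rightarrow> ('a \<Rightarrow> 'd) \<Rightarrow> real" where
  "cond_mutual_information_pmf p X Y Z =
     prob_space.conditional_mutual_information (measure_pmf p) 2
       (count_space UNIV) (count_space UNIV) (count_space UNIV) X Y Z"

lemma information_space_pmf: "information_space (measure_pmf p) 2"
  by (simp add: information_space_def information_space_axioms_def measure_pmf.prob_space_axioms)

lemma distributed_pmf:
  "distributed (measure_pmf p) (count_space UNIV) X (\<lambda>x. ennreal (pmf (map_pmf X p) x))"
proof -
  have "distr (measure_pmf p) (count_space UNIV) X = measure_pmf (map_pmf X p)"
    by (simp add: map_pmf_rep_eq)
  then show ?thesis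
    unfolding distributed_def by (auto intro: trans[OF _ measure_pmf_eq_density])
qed

lemma integrable_count_space_finite_support:
  fixes f :: "'a \<Rightarrow> real"
  assumes "finite A" and "\<And>x. x \<notin> A \<Longrightarrow> f x = 0"
  shows "integrable (count_space UNIV) f"
  unfolding integrable_iff_bounded
  by (subst nn_integral_count_space'[of A]) (use assms in auto)

lemma entropy_pmf_eq:
  assumes "finite (set_pmf p)"
  shows "entropy_pmf p X =
    - (\<Sum>x\<in>X ` set_pmf p. pmf (map_pmf X p) x * log 2 (pmf (map_pmf X p) x))"
proof -
  interpret information_space "measure_pmf p" 2 by (rule information_space_pmf)
  have z: "pmf (map_pmf X p) x = 0" if "x \<notin> X ` set_pmf p" for x
    using that by (simp add: pmf_eq_0_set_pmf)
  have "entropy_pmf p X =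
      - (\<integral>x. pmf (map_pmf X p) x * log 2 (pmf (map_pmf X p) x) \<partial>count_space UNIV)"
    unfolding entropy_pmf_def by (rule entropy_distr[OF distributed_pmf]) simp
  also have "(\<integral>x. pmf (map_pmf X p) x * log 2 (pmf (map_pmf X p) x) \<partial>count_space UNIV) =
      (\<Sum>x\<in>X ` set_pmf p. pmf (map_pmf X p) x * log 2 (pmf (map_pmf X p) x))"
  proof (subst lebesgue_integral_count_space_finite_support)
    let ?f = "\<lambda>x. pmf (map_pmf X p) x * log 2 (pmf (map_pmf X p) x)"
    have sub: "{a \<in> UNIV. ?f a \<noteq> 0} \<subseteq> X ` set_pmf p" using z by auto
    then show "finite {a \<in> UNIV. ?f a \<noteq> 0}" by (rule finite_subset) (simp add: assms)
    show "sum ?f {a. a \<in> UNIV \<and> ?f a \<noteq> 0} = sum ?f (X ` set_pmf p)"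
      using sub assms by (intro sum.mono_neutral_left) auto
  qed
  finally show ?thesis .
qed

lemma cond_entropy_pmf_eq:
  fixes X :: "'a \<Rightarrow> 'b::countable" and Y :: "'a \<Rightarrow> 'c::countable"
  assumes "finite (set_pmf p)"
  shows "cond_entropy_pmf p X Y = entropy_pmf p (\<lambda>v. (X v, Y v)) - entropy_pmf p Y"
proof -
  interpret information_space "measure_pmf p" 2 by (rule information_space_pmf)
  have S: "sigma_finite_measure (count_space (UNIV :: 'b set))"
    and T: "sigma_finite_measure (count_space (UNIV :: 'c set))"
    by (simp_all add: sigma_finite_measure_count_space_countable)
  have P: "count_space (UNIV :: 'b set) \<Otimes>\<^sub>M count_space (UNIV :: 'c set) = count_space UNIV"
    by (simp add: pair_measure_countable)
  have F: "finite ((\<lambda>v. (X v, Y v)) ` set_pmf p)" using assms by simp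
  show ?thesis
    unfolding cond_entropy_pmf_def entropy_pmf_def P[symmetric]
    by (rule conditional_entropy_eq_entropy[OF S T distributed_pmf _ distributed_pmf[of p "\<lambda>v. (X v, Y v)", folded P]])
       (auto simp: P intro!: integrable_count_space_finite_support[OF F] simp: pmf_eq_0_set_pmf)
qed

lemma cond_mutual_information_pmf_eq:
  fixes X :: "'a \<Rightarrow> 'b::countable" and Y :: "'a \<Rightarrow> 'c::countable" and Z :: "'a \<Rightarrow> 'd::countable"
  assumes "finite (set_pmf p)"
  shows "cond_mutual_information_pmf p X Y Z =
    entropy_pmf p (\<lambda>v. (X v, Z v)) + entropy_pmf p (\<lambda>v. (Y v, Z v)) -
    entropy_pmf p (\<lambda>v. (X v, Y v, Z v)) - entropy_pmf p Z"
proof -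
  interpret information_space "measure_pmf p" 2 by (rule information_space_pmf)
  have MI: "prob_space.mutual_information (measure_pmf p) 2 (count_space UNIV) (count_space UNIV) U V =
      entropy_pmf p U + entropy_pmf p V - entropy_pmf p (\<lambda>v. (U v, V v))"
    for U :: "'a \<Rightarrow> 'u::countable" and V :: "'a \<Rightarrow> 'v::countable"
  proof -
    have S: "sigma_finite_measure (count_space (UNIV :: 'u set))"
      and T: "sigma_finite_measure (count_space (UNIV :: 'v set))"
      by (simp_all add: sigma_finite_measure_count_space_countable)
    have P: "count_space (UNIV :: 'u set) \<Otimes>\<^sub>M count_space (UNIV :: 'v set) = count_space UNIV"
      by (simp add: pair_measure_countable)
    have F: "finite ((\<lambda>v. (U v, V v)) ` set_pmf p)" using assms by simp
    show ?thesis
      unfolding entropy_pmf_def P[symmetric]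
      by (rule mutual_information_eq_entropy_conditional_entropy_distr[OF S T distributed_pmf _ distributed_pmf _ distributed_pmf[of p "\<lambda>v. (U v, V v)", folded P]])
         (auto simp: P intro!: integrable_count_space_finite_support[OF F] simp: pmf_eq_0_set_pmf)
  qed
  have "count_space (UNIV :: 'c set) \<Otimes>\<^sub>M count_space (UNIV :: 'd set) = count_space UNIV"
    by (simp add: pair_measure_countable)
  then show ?thesis
    unfolding cond_mutual_information_pmf_def
      prob_space.conditional_mutual_information_def[OF measure_pmf.prob_space_axioms]
    by (simp add: MI)
qed


section \<open>Discrete memoryless broadcast channels\<close>

type_synonym ('x, 'y, 'z) dmbc = "'x \<Rightarrow> ('y \<times> 'z) pmf"

primrec transmit :: "('x, 'y, 'z) dmbc \<Rightarrow> 'x list \<Rightarrow> ('y \<times> 'z) list pmf" where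
  "transmit W [] = return_pmf []"
| "transmit W (x # xs) =
     do { yz \<leftarrow> W x; yzs \<leftarrow> transmit W xs; return_pmf (yz # yzs) }"

definition channel_joint :: "('x, 'y, 'z) dmbc \<Rightarrow> 'x pmf \<Rightarrow> ('x \<times> 'y \<times> 'z) pmf" where
  "channel_joint W P = do { x \<leftarrow> P; (y, z) \<leftarrow> W x; return_pmf (x, y, z) }"

text \<open>\<open>I(X; Y | Z)\<close> for input distribution \<open>P\<close>.\<close>

definition channel_cmi :: "('x, 'y, 'z) dmbc \<Rightarrow> 'x pmf \<Rightarrow> real" where
  "channel_cmi W P =
     cond_mutual_information_pmf (channel_joint W P) (\<lambda>(x, y, z). x) (\<lambda>(x, y, z). y) (\<lambda>(x, y, z). z)"

text \<open>
  A supremum of \<^term>\<open>channel_cmi W\<close> over all input distributions is a maximum.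
\<close>

lemma continuous_on_x_log_x: "continuous_on {0..} (\<lambda>t::real. t * log 2 t)"
  unfolding continuous_on_def
proof
  fix t :: real assume t: "t \<in> {0..}"
  show "((\<lambda>t. t * log 2 t) \<longlongrightarrow> t * log 2 t) (at t within {0..})"
  proof (cases "t = 0")
    case True
    have "((\<lambda>t::real. t * log 2 t) \<longlongrightarrow> 0) (at_right 0)" by real_asymp
    then show ?thesis using True by (simp add: at_within_Ici_at_right)
  next
    case False then show ?thesis using t by (auto intro!: tendsto_intros)
  qed
qed

lemma channel_cmi_attains_max:
  fixes W :: "('x::finite, 'y::finite, 'z::finite) dmbc"
  shows "\<exists>P. \<forall>Q. channel_cmi W Q \<le> channel_cmi W P"
proof -
  define g :: "real \<Rightarrow> real" where "g t = t * log 2 t" for t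
  define K where "K x y z = pmf (W x) (y, z)" for x y z
  define F :: "real ^ 'x \<Rightarrow> real" where "F v =
    - (\<Sum>(x, z) \<in> UNIV. g (\<Sum>y\<in>UNIV. v $ x * K x y z))
    - (\<Sum>(y, z) \<in> UNIV. g (\<Sum>x\<in>UNIV. v $ x * K x y z))
    + (\<Sum>(x, y, z) \<in> UNIV. g (v $ x * K x y z))
    + (\<Sum>z \<in> UNIV. g (\<Sum>x\<in>UNIV. \<Sum>y\<in>UNIV. v $ x * K x y z))" for v
  define \<Delta> :: "(real ^ 'x) set" where "\<Delta> = {v. (\<forall>x. 0 \<le> v $ x) \<and> (\<Sum>x\<in>UNIV. v $ x) = 1}"
  have K0: "0 \<le> K x y z" for x y z unfolding K_def by simp
  have joint: "pmf (channel_joint W P) w = pmf P (fst w) * K (fst w) (fst (snd w)) (snd (snd w))"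
    for P w
  proof -
    obtain x y z where w: "w = (x, y, z)" by (cases w)
    have "channel_joint W P = bind_pmf P (\<lambda>x. map_pmf (Pair x) (W x))"
      unfolding channel_joint_def map_pmf_def by (intro bind_pmf_cong refl) auto
    moreover have "pmf (map_pmf (Pair x') (W x')) (x, y, z) = indicator {x} x' * K x y z" for x'
      unfolding K_def
      by (cases "x' = x") (auto simp: pmf_map_inj' inj_on_def pmf_eq_0_set_pmf)
    ultimately show ?thesis
      by (simp add: pmf_bind measure_pmf_single w)
  qed
  have ent: "entropy_pmf (channel_joint W P) f =
      - (\<Sum>u\<in>UNIV. g (\<Sum>w | f w = u. pmf (channel_joint W P) w))" for P and f :: "_ \<Rightarrow> 'u::finite"
  proof -
    have "entropy_pmf (channel_joint W P) f = - (\<Sum>u\<in>UNIV. g (pmf (map_pmf f (channel_joint W P)) u))"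
      unfolding g_def
      by (subst entropy_pmf_eq) (auto intro!: sum.mono_neutral_left simp: pmf_eq_0_set_pmf)
    moreover have "pmf (map_pmf f (channel_joint W P)) u = (\<Sum>w | f w = u. pmf (channel_joint W P) w)" for u
      by (simp add: pmf_map vimage_def measure_measure_pmf_finite)
    ultimately show ?thesis by simp
  qed
  have FF: "channel_cmi W P = F (\<chi> x. pmf P x)" for P
  proof -
    have s1: "(\<Sum>w | (case w of (x, y, z) \<Rightarrow> (x, z)) = u. h w) = (\<Sum>y\<in>UNIV. h (fst u, y, snd u))"
      for u :: "'x \<times> 'z" and h :: "'x \<times> 'y \<times> 'z \<Rightarrow> real"
      by (rule sum.reindex_bij_witness[of _ "\<lambda>y. (fst u, y, snd u)" "\<lambda>(x, y, z). y"]) auto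
    have s2: "(\<Sum>w | (case w of (x, y, z) \<Rightarrow> (y, z)) = u. h w) = (\<Sum>x\<in>UNIV. h (x, fst u, snd u))"
      for u :: "'y \<times> 'z" and h :: "'x \<times> 'y \<times> 'z \<Rightarrow> real"
      by (rule sum.reindex_bij_witness[of _ "\<lambda>x. (x, fst u, snd u)" "\<lambda>(x, y, z). x"]) auto
    have s3: "(\<Sum>w | (case w of (x, y, z) \<Rightarrow> z) = u. h w) = (\<Sum>x\<in>UNIV. \<Sum>y\<in>UNIV. h (x, y, u))"
      for u :: 'z and h :: "'x \<times> 'y \<times> 'z \<Rightarrow> real"
      unfolding sum.cartesian_product
      by (rule sum.reindex_bij_witness[of _ "\<lambda>(x, y). (x, y, u)" "\<lambda>(x, y, z). (x, y)"]) auto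
    have "channel_cmi W P =
        entropy_pmf (channel_joint W P) (\<lambda>(x, y, z). (x, z)) +
        entropy_pmf (channel_joint W P) (\<lambda>(x, y, z). (y, z)) -
        entropy_pmf (channel_joint W P) (\<lambda>w. w) -
        entropy_pmf (channel_joint W P) (\<lambda>(x, y, z). z)"
      unfolding channel_cmi_def
      by (subst cond_mutual_information_pmf_eq) (auto simp: case_prod_beta')
    also have "\<dots> = F (\<chi> x. pmf P x)"
      unfolding ent s1 s2 s3 F_def by (simp add: joint case_prod_beta')
    finally show ?thesis .
  qed
  have "compact \<Delta>"
    unfolding compact_eq_bounded_closed
  proof
    have "norm v \<le> 1" if "v \<in> \<Delta>" for v
      using norm_le_l1_cart[of v] that by (simp add: \<Delta>_def)
    then show "bounded \<Delta>" unfolding bounded_iff by blast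
    show "closed \<Delta>" unfolding \<Delta>_def
      by (intro closed_Collect_conj closed_Collect_all closed_Collect_le closed_Collect_eq continuous_intros)
  qed
  moreover have "(\<chi> x. pmf P x) \<in> \<Delta>" for P :: "'x pmf"
    unfolding \<Delta>_def by (simp add: sum_pmf_eq_1)
  moreover have "continuous_on \<Delta> F"
  proof -
    have "continuous_on \<Delta> (\<lambda>v. g (f v))"
      if "continuous_on \<Delta> f" "\<And>v. v \<in> \<Delta> \<Longrightarrow> 0 \<le> f v" for f :: "real ^ 'x \<Rightarrow> real"
      using continuous_on_compose2[OF continuous_on_x_log_x that(1)] that(2)
      unfolding g_def by auto
    note g = this
    show ?thesis
      unfolding F_def case_prod_beta'
      by (intro continuous_on_add continuous_on_diff continuous_on_minus continuous_on_sum g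
            continuous_on_mult continuous_on_component continuous_on_const continuous_on_id sum_nonneg)
         (auto simp: \<Delta>_def K0 intro!: mult_nonneg_nonneg)
  qed
  ultimately obtain v where v: "v \<in> \<Delta>" "\<And>w. w \<in> \<Delta> \<Longrightarrow> F w \<le> F v"
    using continuous_attains_sup[of \<Delta> F] by blast
  have "pmf (embed_pmf (\<lambda>x. v $ x)) x = v $ x" for x
    using v(1) by (intro pmf_embed_pmf) (auto simp: \<Delta>_def nn_integral_count_space_finite sum_ennreal)
  then have "(\<chi> x. pmf (embed_pmf (\<lambda>x. v $ x)) x) = v" by (simp add: vec_eq_iff)
  then have "channel_cmi W (embed_pmf (\<lambda>x. v $ x)) = F v" unfolding FF by (rule arg_cong)
  then show ?thesis using v(2) \<open>\<And>P. (\<chi> x. pmf P x) \<in> \<Delta>\<close> FF by metis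
qed


section \<open>Secret key establishment protocols\<close>

text \<open>
  A view lists, in chronological order, one entry per round: \<open>Inl\<close> marks a round over the forward
  channel and \<open>Inr\<close> a round over the backward channel.
\<close>

type_synonym ('xf, 'yb) view_A = "('xf list + 'yb list) list"
type_synonym ('yf, 'xb) view_B = "('yf list + 'xb list) list"
type_synonym ('zf, 'zb) view_E = "('zf list + 'zb list) list"

text \<open>
  A round consists of the number of channel uses and of the sender's encoder, which is a stochastic
  kernel: the sequence is drawn from a distribution that depends only on what the sender has sent
  and received so far, so the local randomness is independent of everything else. Randomness kept
  secretly from one round to the next adds nothing: views record only sent and received sequences,
  and conditioning such randomness on the sender's view gives a kernel of this kind that induces
  the same joint distribution of the three views.
\<close>

datatype ('xf, 'yf, 'xb, 'yb) ske_round =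
    Forward nat "('xf, 'yb) view_A \<Rightarrow> 'xf list pmf"
  | Backward nat "('yf, 'xb) view_B \<Rightarrow> 'xb list pmf"

fun valid_round :: "('xf, 'yf, 'xb, 'yb) ske_round \<Rightarrow> bool" where
  "valid_round (Forward n enc) = (\<forall>v. \<forall>xs \<in> set_pmf (enc v). length xs = n)"
| "valid_round (Backward n enc) = (\<forall>v. \<forall>xs \<in> set_pmf (enc v). length xs = n)"

fun is_forward :: "('xf, 'yf, 'xb, 'yb) ske_round \<Rightarrow> bool" where
  "is_forward (Forward n enc) = True"
| "is_forward (Backward n enc) = False"

fun forward_uses :: "('xf, 'yf, 'xb, 'yb) ske_round \<Rightarrow> nat" where
  "forward_uses (Forward n enc) = n"
| "forward_uses (Backward n enc) = 0"

fun backward_uses :: "('xf, 'yf, 'xb, 'yb) ske_round \<Rightarrow> nat" where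
  "backward_uses (Forward n enc) = 0"
| "backward_uses (Backward n enc) = n"

text \<open>
  If \<open>key_by_alice\<close> holds, Alice's output is the key and Bob's is the estimate of it; otherwise the
  roles are exchanged. A view takes
  only finitely many values with positive probability, so letting keys be natural numbers is no
  restriction on the finite key alphabet.
\<close>

record ('xf, 'yf, 'xb, 'yb) ske_protocol =
  rounds :: "('xf, 'yf, 'xb, 'yb) ske_round list"
  output_A :: "('xf, 'yb) view_A \<Rightarrow> nat"
  output_B :: "('yf, 'xb) view_B \<Rightarrow> nat"
  key_by_alice :: bool

definition n_f :: "('xf, 'yf, 'xb, 'yb) ske_protocol \<Rightarrow> nat" where
  "n_f \<pi> = (\<Sum>r\<leftarrow>rounds \<pi>. forward_uses r)"

definition n_b :: "('xf, 'yf, 'xb, 'yb) ske_protocol \<Rightarrow> nat" where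
  "n_b \<pi> = (\<Sum>r\<leftarrow>rounds \<pi>. backward_uses r)"

text \<open>
  The receiver of a round is the sender of the next one, hence the alternation; either direction may
  come first. Rounds of zero channel uses are permitted, so arbitrary schedules are covered.
  At least one channel use is required because the key rate is normalised by their number.
\<close>

definition valid_protocol :: "('xf, 'yf, 'xb, 'yb) ske_protocol \<Rightarrow> bool" where
  "valid_protocol \<pi> \<longleftrightarrow>
     (\<forall>r \<in> set (rounds \<pi>). valid_round r) \<and>
     successively (\<lambda>r r'. is_forward r \<noteq> is_forward r') (rounds \<pi>) \<and>
     0 < n_f \<pi> + n_b \<pi>"

fun run_round ::
    "('xf, 'yf, 'zf) dmbc \<Rightarrow> ('xb, 'yb, 'zb) dmbc \<Rightarrow> ('xf, 'yf, 'xb, 'yb) ske_round \<Rightarrow>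
     ('xf, 'yb) view_A \<times> ('yf, 'xb) view_B \<times> ('zf, 'zb) view_E \<Rightarrow>
     (('xf, 'yb) view_A \<times> ('yf, 'xb) view_B \<times> ('zf, 'zb) view_E) pmf" where
  "run_round Wf Wb (Forward n enc) (a, b, e) =
     do { xs \<leftarrow> enc a; yzs \<leftarrow> transmit Wf xs;
          return_pmf (a @ [Inl xs], b @ [Inl (map fst yzs)], e @ [Inl (map snd yzs)]) }"
| "run_round Wf Wb (Backward n enc) (a, b, e) =
     do { xs \<leftarrow> enc b; yzs \<leftarrow> transmit Wb xs;
          return_pmf (a @ [Inr (map fst yzs)], b @ [Inr xs], e @ [Inr (map snd yzs)]) }"

definition final_views ::
    "('xf, 'yf, 'zf) dmbc \<Rightarrow> ('xb, 'yb, 'zb) dmbc \<Rightarrow> ('xf, 'yf, 'xb, 'yb) ske_protocol \<Rightarrow>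
     (('xf, 'yb) view_A \<times> ('yf, 'xb) view_B \<times> ('zf, 'zb) view_E) pmf" where
  "final_views Wf Wb \<pi> =
     foldl (\<lambda>p r. p \<bind> run_round Wf Wb r) (return_pmf ([], [], [])) (rounds \<pi>)"

lemma finite_set_pmf_transmit:
  fixes W :: "('x::finite, 'y::finite, 'z::finite) dmbc"
  shows "finite (set_pmf (transmit W xs))"
  by (induction xs) auto

lemma finite_set_pmf_final_views:
  fixes Wf :: "('xf::finite, 'yf::finite, 'zf::finite) dmbc"
    and Wb :: "('xb::finite, 'yb::finite, 'zb::finite) dmbc"
  assumes "valid_protocol \<pi>"
  shows "finite (set_pmf (final_views Wf Wb \<pi>))"
proof -
  have lists: "finite A" if "\<And>xs. xs \<in> A \<Longrightarrow> length xs = n" for A :: "'u::finite list set" and n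
    using finite_subset[OF _ finite_lists_length_eq[of "UNIV :: 'u set" n]] that by auto
  have round: "finite (set_pmf (run_round Wf Wb r v))" if "valid_round r" for r v
  proof (cases v)
    case v: (fields a b e)
    show ?thesis
    proof (cases r)
      case (Forward n enc)
      then have "finite (set_pmf (enc a))" using that by (intro lists[of _ n]) auto
      then show ?thesis by (auto simp: v Forward finite_set_pmf_transmit)
    next
      case (Backward n enc)
      then have "finite (set_pmf (enc b))" using that by (intro lists[of _ n]) auto
      then show ?thesis by (auto simp: v Backward finite_set_pmf_transmit)
    qed
  qed
  have "finite (set_pmf (foldl (\<lambda>p r. p \<bind> run_round Wf Wb r) q rs))"
    if "finite (set_pmf q)" "\<forall>r \<in> set rs. valid_round r" for q rs
    using that by (induction rs arbitrary: q) (auto simp: round)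
  then show ?thesis
    using assms by (simp add: final_views_def valid_protocol_def)
qed

definition key ::
    "('xf, 'yf, 'xb, 'yb) ske_protocol \<Rightarrow>
     ('xf, 'yb) view_A \<times> ('yf, 'xb) view_B \<times> ('zf, 'zb) view_E \<Rightarrow> nat" where
  "key \<pi> = (\<lambda>(a, b, e). if key_by_alice \<pi> then output_A \<pi> a else output_B \<pi> b)"

definition key_estimate ::
    "('xf, 'yf, 'xb, 'yb) ske_protocol \<Rightarrow>
     ('xf, 'yb) view_A \<times> ('yf, 'xb) view_B \<times> ('zf, 'zb) view_E \<Rightarrow> nat" where
  "key_estimate \<pi> = (\<lambda>(a, b, e). if key_by_alice \<pi> then output_B \<pi> b else output_A \<pi> a)"

definition eve_view ::
    "('xf, 'yb) view_A \<times> ('yf, 'xb) view_B \<times> ('zf, 'zb) view_E \<Rightarrow> ('zf, 'zb) view_E" where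
  "eve_view = (\<lambda>(a, b, e). e)"

definition secure_ske ::
    "('xf, 'yf, 'zf) dmbc \<Rightarrow> ('xb, 'yb, 'zb) dmbc \<Rightarrow> real \<Rightarrow> real \<Rightarrow>
     ('xf, 'yf, 'xb, 'yb) ske_protocol \<Rightarrow> bool" where
  "secure_ske Wf Wb R \<delta> \<pi> \<longleftrightarrow>
     (let V = final_views Wf Wb \<pi>; H_S = entropy_pmf V (key \<pi>) in
        H_S / real (n_f \<pi> + n_b \<pi>) > R - \<delta> \<and>
        measure_pmf.prob V {v. key_estimate \<pi> v \<noteq> key \<pi> v} < \<delta> \<and>
        (H_S = 0 \<or> cond_entropy_pmf V (key \<pi>) eve_view / H_S > 1 - \<delta>))"

definition achievable_rate :: "('xf, 'yf, 'zf) dmbc \<Rightarrow> ('xb, 'yb, 'zb) dmbc \<Rightarrow> real \<Rightarrow> bool" where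
  "achievable_rate Wf Wb R \<longleftrightarrow>
     0 \<le> R \<and>
     (\<forall>\<delta>. 0 < \<delta> \<and> \<delta> \<le> 1 \<longrightarrow>
        (\<exists>\<pi> :: ('xf, 'yf, 'xb, 'yb) ske_protocol. valid_protocol \<pi> \<and> secure_ske Wf Wb R \<delta> \<pi>))"

text \<open>
  The supremum is taken in the extended reals, so that it is meaningful without first proving
  boundedness. The achievable rates form a nonempty closed set by the two lemmas below, so a finite
  supremum is the largest achievable rate.
\<close>

definition sk_capacity :: "('xf, 'yf, 'zf) dmbc \<Rightarrow> ('xb, 'yb, 'zb) dmbc \<Rightarrow> ereal" where
  "sk_capacity Wf Wb = (SUP R \<in> {R. achievable_rate Wf Wb R}. ereal R)"

lemma achievable_rate_closed:
  assumes "0 \<le> R" and lim: "\<And>\<epsilon>. 0 < \<epsilon> \<Longrightarrow> \<exists>R'. R - \<epsilon> < R' \<and> achievable_rate Wf Wb R'"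
  shows "achievable_rate Wf Wb R"
  unfolding achievable_rate_def
proof (intro conjI allI impI)
  fix \<delta> :: real assume \<delta>: "0 < \<delta> \<and> \<delta> \<le> 1"
  obtain R' where R': "R - \<delta> / 2 < R'" "achievable_rate Wf Wb R'"
    using lim[of "\<delta> / 2"] \<delta> by auto
  then obtain \<pi> where "valid_protocol \<pi>" "secure_ske Wf Wb R' (\<delta> / 2) \<pi>"
    using \<delta> unfolding achievable_rate_def by (metis half_gt_zero field_sum_of_halves less_eq_real_def add_increasing2 order_trans)
  moreover have "secure_ske Wf Wb R \<delta> \<pi>" if "secure_ske Wf Wb R' (\<delta> / 2) \<pi>" for \<pi>
    using that R' \<delta> unfolding secure_ske_def Let_def by (auto; linarith)
  ultimately show "\<exists>\<pi>. valid_protocol \<pi> \<and> secure_ske Wf Wb R \<delta> \<pi>" by blast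
qed fact

lemma achievable_rate_0:
  fixes Wf :: "('xf::finite, 'yf::finite, 'zf::finite) dmbc"
    and Wb :: "('xb::finite, 'yb::finite, 'zb::finite) dmbc"
  shows "achievable_rate Wf Wb 0"
proof -
  define \<pi> :: "('xf, 'yf, 'xb, 'yb) ske_protocol" where
    "\<pi> = \<lparr>rounds = [Forward 1 (\<lambda>_. return_pmf [undefined])],
          output_A = (\<lambda>_. 0), output_B = (\<lambda>_. 0), key_by_alice = True\<rparr>"
  have valid: "valid_protocol \<pi>"
    by (simp add: valid_protocol_def \<pi>_def n_f_def)
  have key: "key \<pi> = (\<lambda>_. 0)" "key_estimate \<pi> = (\<lambda>_. 0)"
    by (auto simp: key_def key_estimate_def \<pi>_def)
  have "entropy_pmf (final_views Wf Wb \<pi>) (\<lambda>_. 0 :: nat) = 0"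
    by (subst entropy_pmf_eq[OF finite_set_pmf_final_views[OF valid]])
       (simp add: set_pmf_not_empty image_constant_conv)
  then have "secure_ske Wf Wb 0 \<delta> \<pi>" if "0 < \<delta>" for \<delta>
    using that by (simp add: secure_ske_def key)
  with valid show ?thesis unfolding achievable_rate_def by blast
qed

end

theory Submission
  imports Defs
begin

text \<open>
  The quantity \<open>I(View_A; View_B | View_E)\<close> starts at zero. Local randomness of the sender
  leaves it unchanged, and a single channel use increases it by at most the conditional mutual
  information of that channel for the current input distribution, because
  \<open>I(A; B Y | E Z) \<le> I(A; B | E) + I(X; Y | Z)\<close> when \<open>X\<close> is a function of \<open>A\<close> and
  \<open>(Y, Z)\<close> depends on the past only through \<open>X\<close>. Hence it is at most \<open>n C\<close> after \<open>n\<close> uses,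
  where \<open>C\<close> is the claimed bound. By data processing and Fano's inequality, \<open>H(S | View_E)\<close>
  exceeds it by at most \<open>n\<close> times a quantity that vanishes with \<open>\<delta>\<close>: the number of possible
  views, hence of keys, is at most exponential in \<open>n\<close>.
\<close>

section \<open>Entropy on finitely supported laws\<close>

lemma pmf_map_eq_sum:
  assumes "finite (set_pmf p)"
  shows "pmf (map_pmf f p) y = (\<Sum>x | x \<in> set_pmf p \<and> f x = y. pmf p x)"
proof -
  have "pmf (map_pmf f p) y = measure (measure_pmf p) (f -` {y} \<inter> set_pmf p)"
    by (simp add: pmf_map measure_Int_set_pmf)
  also have "f -` {y} \<inter> set_pmf p = {x. x \<in> set_pmf p \<and> f x = y}" by auto
  finally show ?thesis using assms by (simp add: measure_measure_pmf_finite)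
qed

text \<open>The values of \<open>X\<close> are grouped into fibres. Summing over sample points gives
  the entropies of different random variables one common index set, so that they combine
  termwise.\<close>

lemma entropy_pmf_eq_expectation:
  assumes "finite (set_pmf p)"
  shows "entropy_pmf p X = - (\<Sum>v\<in>set_pmf p. pmf p v * log 2 (pmf (map_pmf X p) (X v)))"
proof -
  have "(\<Sum>v\<in>set_pmf p. pmf p v * log 2 (pmf (map_pmf X p) (X v))) =
      (\<Sum>x\<in>X ` set_pmf p. \<Sum>v | v \<in> set_pmf p \<and> X v = x. pmf p v * log 2 (pmf (map_pmf X p) (X v)))"
    by (rule sum.image_gen[OF assms])
  also have "\<dots> = (\<Sum>x\<in>X ` set_pmf p. pmf (map_pmf X p) x * log 2 (pmf (map_pmf X p) x))"
  proof (rule sum.cong[OF refl])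
    fix x
    have "(\<Sum>v | v \<in> set_pmf p \<and> X v = x. pmf p v * log 2 (pmf (map_pmf X p) (X v))) =
       (\<Sum>v | v \<in> set_pmf p \<and> X v = x. pmf p v) * log 2 (pmf (map_pmf X p) x)"
      by (simp add: sum_distrib_right)
    then show "(\<Sum>v | v \<in> set_pmf p \<and> X v = x. pmf p v * log 2 (pmf (map_pmf X p) (X v))) =
       pmf (map_pmf X p) x * log 2 (pmf (map_pmf X p) x)"
      by (simp add: pmf_map_eq_sum[OF assms])
  qed
  finally show ?thesis by (simp add: entropy_pmf_eq[OF assms])
qed

lemma entropy_pmf_map:
  assumes "finite (set_pmf p)"
  shows "entropy_pmf (map_pmf g p) X = entropy_pmf p (\<lambda>v. X (g v))"
  using assms by (simp add: entropy_pmf_eq map_pmf_comp image_image)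

lemma entropy_pmf_inj:
  assumes "finite (set_pmf p)" and "inj_on f (X ` set_pmf p)"
  shows "entropy_pmf p (\<lambda>v. f (X v)) = entropy_pmf p X"
proof -
  have "pmf (map_pmf (\<lambda>v. f (X v)) p) (f (X v)) = pmf (map_pmf X p) (X v)" if "v \<in> set_pmf p" for v
    using pmf_map_inj[of f "map_pmf X p" "X v"] assms(2) that by (simp add: map_pmf_comp)
  then show ?thesis using assms(1) by (simp add: entropy_pmf_eq_expectation)
qed

text \<open>On the support \<open>Y\<close> is an injective function of \<open>X\<close>: choose any
  sample point with the given value of \<open>X\<close> and read off \<open>Y\<close>. This serves
  to reorder tuples and to drop components determined by the others.\<close>

lemma entropy_pmf_same_info:
  assumes "finite (set_pmf p)"
    and "\<And>v w. v \<in> set_pmf p \<Longrightarrow> w \<in> set_pmf p \<Longrightarrow> X v = X w \<longleftrightarrow> Y v = Y w"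
  shows "entropy_pmf p X = entropy_pmf p Y"
proof -
  define f where "f x = Y (SOME v. v \<in> set_pmf p \<and> X v = x)" for x
  have f: "f (X v) = Y v" if "v \<in> set_pmf p" for v
    unfolding f_def using someI[of "\<lambda>w. w \<in> set_pmf p \<and> X w = X v" v] assms(2) that by metis
  have "entropy_pmf p Y = entropy_pmf p (\<lambda>v. f (X v))"
    using assms(1) f by (simp add: entropy_pmf_eq_expectation cong: map_pmf_cong)
  also have "\<dots> = entropy_pmf p X"
    using assms f by (intro entropy_pmf_inj) (auto simp: inj_on_def)
  finally show ?thesis by simp
qed

section \<open>Gibbs' inequality and submodularity\<close>

text \<open>The bound \<open>ln t \<le> t - 1\<close> at \<open>t = q x / pmf p x\<close>, averaged
  over \<open>p\<close>. Allowing total mass below 1 lets reference weights be restricted to the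
  support of \<open>p\<close>.\<close>

lemma gibbs_inequality:
  fixes q :: "'a \<Rightarrow> real"
  assumes "finite (set_pmf p)" and q: "\<And>x. x \<in> set_pmf p \<Longrightarrow> 0 < q x"
    and "(\<Sum>x\<in>set_pmf p. q x) \<le> 1"
  shows "entropy_pmf p (\<lambda>x. x) \<le> - (\<Sum>x\<in>set_pmf p. pmf p x * log 2 (q x))"
proof -
  have "(\<Sum>x\<in>set_pmf p. pmf p x * ln (q x)) - (\<Sum>x\<in>set_pmf p. pmf p x * ln (pmf p x)) =
      (\<Sum>x\<in>set_pmf p. pmf p x * (ln (q x) - ln (pmf p x)))"
    by (simp add: sum_subtractf right_diff_distrib)
  also have "\<dots> \<le> (\<Sum>x\<in>set_pmf p. q x - pmf p x)"
  proof (rule sum_mono)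
    fix x assume x: "x \<in> set_pmf p"
    then have p: "0 < pmf p x" by (simp add: pmf_positive)
    have "ln (q x) - ln (pmf p x) = ln (q x / pmf p x)"
      using p q[OF x] by (simp add: ln_div)
    also have "\<dots> \<le> q x / pmf p x - 1"
      using p q[OF x] by (intro ln_le_minus_one) simp
    finally have "pmf p x * (ln (q x) - ln (pmf p x)) \<le> pmf p x * (q x / pmf p x - 1)"
      using p by (intro mult_left_mono) auto
    also have "\<dots> = q x - pmf p x"
      using p by (simp add: right_diff_distrib)
    finally show "pmf p x * (ln (q x) - ln (pmf p x)) \<le> q x - pmf p x" .
  qed
  also have "\<dots> \<le> 0"
    using assms by (simp add: sum_subtractf sum_pmf_eq_1)
  finally show ?thesis
    using assms(1)
    by (simp add: entropy_pmf_eq_expectation log_def sum_divide_distrib[symmetric] divide_right_mono)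
qed

lemma sum_pmf_fst:
  assumes "finite (set_pmf p)" and "fst ` set_pmf p \<subseteq> A" and "finite A"
  shows "(\<Sum>x\<in>A. pmf p (x, z)) = pmf (map_pmf snd p) z"
proof -
  have "(\<Sum>w | w \<in> set_pmf p \<and> snd w = z. pmf p w) = (\<Sum>w\<in>(\<lambda>x. (x, z)) ` A. pmf p w)"
    using assms by (intro sum.mono_neutral_left) (force simp: pmf_eq_0_set_pmf)+
  also have "\<dots> = (\<Sum>x\<in>A. pmf p (x, z))"
    by (subst sum.reindex) (auto simp: inj_on_def)
  finally show ?thesis using assms(1) by (simp add: pmf_map_eq_sum)
qed

text \<open>This is I(X; Y | Z) >= 0: Gibbs' inequality compares the joint law with P(x,z) P(y,z) /
  P(z), under which X and Y are conditionally independent given Z.\<close>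

lemma entropy_pmf_submodular:
  assumes fin: "finite (set_pmf p)"
  shows "entropy_pmf p (\<lambda>v. (X v, Y v, Z v)) + entropy_pmf p Z \<le>
    entropy_pmf p (\<lambda>v. (X v, Z v)) + entropy_pmf p (\<lambda>v. (Y v, Z v))"
proof -
  define r where "r = map_pmf (\<lambda>v. (X v, Y v, Z v)) p"
  define a where "a = map_pmf (\<lambda>(x, y, z). (x, z)) r"
  define b where "b = map_pmf (\<lambda>(x, y, z). (y, z)) r"
  define c where "c = map_pmf (\<lambda>(x, y, z). z) r"
  define S where "S = set_pmf r"
  define q where "q = (\<lambda>(x, y, z). pmf a (x, z) * pmf b (y, z) / pmf c z)"
  have S: "finite S" using fin by (simp add: S_def r_def)
  have abc: "set_pmf a = (\<lambda>(x, y, z). (x, z)) ` S" "set_pmf b = (\<lambda>(x, y, z). (y, z)) ` S"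
     "set_pmf c = (\<lambda>(x, y, z). z) ` S"
    by (simp_all add: a_def b_def c_def S_def)
  have pos: "0 < pmf a (x, z)" "0 < pmf b (y, z)" "0 < pmf c z" if "(x, y, z) \<in> S" for x y z
    using that by (force intro!: pmf_positive simp: abc)+
  have c: "map_pmf snd a = c" "map_pmf snd b = c"
    by (simp_all add: a_def b_def c_def map_pmf_comp case_prod_beta')
  let ?x = "fst ` S" let ?y = "(fst \<circ> snd) ` S" let ?z = "(snd \<circ> snd) ` S"
  \<comment> \<open>Enlarging the support to the product of the three ranges makes the mass
    computable: for fixed \<open>z\<close>, the sums over \<open>x\<close> and \<open>y\<close> both
    give \<open>pmf c z\<close>, one of which cancels the denominator.\<close>
  have "sum q S \<le> sum q (?x \<times> ?y \<times> ?z)"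
    using S by (intro sum_mono2) (force simp: q_def)+
  also have "\<dots> = (\<Sum>x\<in>?x. \<Sum>y\<in>?y. \<Sum>z\<in>?z. pmf a (x, z) * pmf b (y, z) / pmf c z)"
    by (simp add: sum.cartesian_product q_def)
  also have "\<dots> = (\<Sum>x\<in>?x. \<Sum>z\<in>?z. \<Sum>y\<in>?y. pmf a (x, z) * pmf b (y, z) / pmf c z)"
    by (intro sum.cong refl sum.swap)
  also have "\<dots> = (\<Sum>z\<in>?z. \<Sum>x\<in>?x. \<Sum>y\<in>?y. pmf a (x, z) * pmf b (y, z) / pmf c z)"
    by (rule sum.swap)
  also have "\<dots> = (\<Sum>z\<in>?z. (\<Sum>x\<in>?x. pmf a (x, z)) * (\<Sum>y\<in>?y. pmf b (y, z)) / pmf c z)"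
    by (simp add: sum_product sum_divide_distrib)
  also have "\<dots> = (\<Sum>z\<in>?z. pmf c z)"
  proof (rule sum.cong[OF refl])
    fix z
    have "(\<Sum>x\<in>?x. pmf a (x, z)) = pmf c z" "(\<Sum>y\<in>?y. pmf b (y, z)) = pmf c z"
      using S by (subst sum_pmf_fst; force simp: abc c)+
    then show "(\<Sum>x\<in>?x. pmf a (x, z)) * (\<Sum>y\<in>?y. pmf b (y, z)) / pmf c z = pmf c z" by simp
  qed
  also have "\<dots> = 1"
    using S by (intro sum_pmf_eq_1) (force simp: abc)+
  finally have "entropy_pmf r (\<lambda>x. x) \<le> - (\<Sum>x\<in>S. pmf r x * log 2 (q x))"
    unfolding S_def using S pos by (intro gibbs_inequality) (auto simp: S_def q_def)
  also have "(\<Sum>x\<in>S. pmf r x * log 2 (q x)) =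
      (\<Sum>(x, y, z)\<in>S. pmf r (x, y, z) * log 2 (pmf a (x, z)) + pmf r (x, y, z) * log 2 (pmf b (y, z))
         - pmf r (x, y, z) * log 2 (pmf c z))"
    using pos
    by (intro sum.cong refl) (auto simp: q_def log_mult_pos log_divide_pos algebra_simps less_imp_neq[THEN not_sym])
  also have "- \<dots> = entropy_pmf r (\<lambda>(x, y, z). (x, z)) + entropy_pmf r (\<lambda>(x, y, z). (y, z))
      - entropy_pmf r (\<lambda>(x, y, z). z)"
    using S unfolding S_def
    by (simp add: entropy_pmf_eq_expectation a_def b_def c_def case_prod_beta' sum.distrib sum_subtractf)
  finally show ?thesis
    using fin by (simp add: r_def entropy_pmf_map)
qed

section \<open>Chain rule for kernels and Fano's inequality\<close>

text \<open>The joint mass factors as \<open>pmf q v * pmf (L v) w\<close>, so its logarithm splits.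
  The second part averages to the conditional entropy, which here is the mean entropy of the kernel
  laws.\<close>

lemma entropy_pmf_bind_Pair:
  assumes "finite (set_pmf q)" and "\<And>v. v \<in> set_pmf q \<Longrightarrow> finite (set_pmf (L v))"
  shows "entropy_pmf (bind_pmf q (\<lambda>v. map_pmf (Pair v) (L v))) (\<lambda>w. w) =
    entropy_pmf q (\<lambda>v. v) + measure_pmf.expectation q (\<lambda>v. entropy_pmf (L v) (\<lambda>w. w))"
proof -
  let ?p = "bind_pmf q (\<lambda>v. map_pmf (Pair v) (L v))"
  have p: "pmf ?p (v, w) = pmf q v * pmf (L v) w" for v w
  proof -
    have "pmf (map_pmf (Pair v') (L v')) (v, w) = indicator {v} v' * pmf (L v) w" for v'
      by (cases "v' = v") (auto simp: pmf_map_inj' inj_on_def pmf_eq_0_set_pmf)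
    then show ?thesis by (simp add: pmf_bind measure_pmf_single)
  qed
  have set: "set_pmf ?p = (SIGMA v : set_pmf q. set_pmf (L v))" by auto
  then have fin: "finite (set_pmf ?p)" using assms by simp
  have "entropy_pmf ?p (\<lambda>w. w) =
      - (\<Sum>v\<in>set_pmf q. \<Sum>w\<in>set_pmf (L v). pmf ?p (v, w) * log 2 (pmf ?p (v, w)))"
    unfolding entropy_pmf_eq_expectation[OF fin] set
    using assms by (subst sum.Sigma) (auto simp: case_prod_beta')
  also have "(\<Sum>v\<in>set_pmf q. \<Sum>w\<in>set_pmf (L v). pmf ?p (v, w) * log 2 (pmf ?p (v, w))) =
      (\<Sum>v\<in>set_pmf q. pmf q v * log 2 (pmf q v) - pmf q v * entropy_pmf (L v) (\<lambda>w. w))"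
  proof (rule sum.cong[OF refl])
    fix v assume v: "v \<in> set_pmf q"
    have "(\<Sum>w\<in>set_pmf (L v). pmf ?p (v, w) * log 2 (pmf ?p (v, w))) =
        (\<Sum>w\<in>set_pmf (L v). pmf q v * log 2 (pmf q v) * pmf (L v) w +
            pmf q v * (pmf (L v) w * log 2 (pmf (L v) w)))"
      unfolding p using v
      by (intro sum.cong refl) (simp add: log_mult_pos pmf_positive algebra_simps)
    also have "\<dots> = pmf q v * log 2 (pmf q v) - pmf q v * entropy_pmf (L v) (\<lambda>w. w)"
      using assms(2)[OF v]
      by (simp add: entropy_pmf_eq_expectation sum.distrib sum_distrib_left[symmetric] sum_pmf_eq_1)
    finally show "(\<Sum>w\<in>set_pmf (L v). pmf ?p (v, w) * log 2 (pmf ?p (v, w))) =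
        pmf q v * log 2 (pmf q v) - pmf q v * entropy_pmf (L v) (\<lambda>w. w)" .
  qed
  finally show ?thesis
    using assms(1)
    by (simp add: entropy_pmf_eq_expectation[of q] sum_subtractf integral_measure_pmf_real[of "set_pmf q"]
        mult.commute)
qed

text \<open>The left side is H(S | T). When \<open>N\<close> is exponential in the number of channel
  uses, the right side per use is still bounded by a quantity vanishing with
  \<open>\<delta>\<close>.\<close>

lemma fano_inequality:
  assumes fin: "finite (set_pmf p)" and card: "card (S ` set_pmf p) \<le> N"
    and err: "measure_pmf.prob p {v. T v \<noteq> S v} \<le> \<delta>" and \<delta>: "0 < \<delta>" "\<delta> < 1"
  shows "entropy_pmf p (\<lambda>v. (S v, T v)) - entropy_pmf p T \<le>
    - log 2 (1 - \<delta>) + \<delta> * (log 2 N - log 2 \<delta>)"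
proof -
  define r where "r = map_pmf (\<lambda>v. (S v, T v)) p"
  define t where "t = map_pmf T p"
  \<comment> \<open>Gibbs' inequality is applied to the reference law \<open>t(u) w(s|u)\<close>, whose total mass is at most 1;
    this avoids the binary entropy of the error event.\<close>
  define w where "w s u = (if s = u then 1 - \<delta> else \<delta> / N)" for s u :: 'b
  have "S ` set_pmf p \<noteq> {}" by (simp add: set_pmf_not_empty)
  then have "card (S ` set_pmf p) \<noteq> 0" using fin by simp
  then have N: "0 < N" using card by linarith
  have w: "0 < w s u" for s u using N \<delta> by (simp add: w_def)
  have setr: "set_pmf r = (\<lambda>v. (S v, T v)) ` set_pmf p" by (simp add: r_def)
  have t: "map_pmf snd r = t" by (simp add: r_def t_def map_pmf_comp)
  have "(\<Sum>(s, u)\<in>set_pmf r. pmf t u * w s u) \<le>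
      (\<Sum>(s, u)\<in>(S ` set_pmf p) \<times> (T ` set_pmf p). pmf t u * w s u)"
    using fin w by (intro sum_mono2) (auto simp: setr less_imp_le)
  also have "\<dots> = (\<Sum>s\<in>S ` set_pmf p. \<Sum>u\<in>T ` set_pmf p. pmf t u * w s u)"
    by (simp add: sum.cartesian_product)
  also have "\<dots> = (\<Sum>u\<in>T ` set_pmf p. pmf t u * (\<Sum>s\<in>S ` set_pmf p. w s u))"
    by (subst sum.swap) (simp add: sum_distrib_left)
  also have "\<dots> \<le> (\<Sum>u\<in>T ` set_pmf p. pmf t u * 1)"
  proof (intro sum_mono mult_left_mono)
    fix u
    \<comment> \<open>At most one \<open>s\<close> equals \<open>u\<close>; granting
      \<open>\<delta> / N\<close> to that one as well leaves a constant summed over at most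
      \<open>N\<close> values.\<close>
    have "(\<Sum>s\<in>S ` set_pmf p. w s u) \<le> (\<Sum>s\<in>S ` set_pmf p. (if s = u then 1 - \<delta> else 0) + \<delta> / N)"
      using \<delta> by (intro sum_mono) (simp add: w_def)
    also have "\<dots> \<le> (1 - \<delta>) + card (S ` set_pmf p) * (\<delta> / N)"
      using fin \<delta> by (simp add: sum.distrib sum.delta)
    also have "\<dots> \<le> (1 - \<delta>) + N * (\<delta> / N)"
      using card \<delta> by (intro add_left_mono mult_right_mono) auto
    finally show "(\<Sum>s\<in>S ` set_pmf p. w s u) \<le> 1" using N by simp
  qed simp
  also have "\<dots> = 1" using fin by (simp add: t_def sum_pmf_eq_1)
  finally have "entropy_pmf r (\<lambda>x. x) \<le>
      - (\<Sum>x\<in>set_pmf r. pmf r x * log 2 (case x of (s, u) \<Rightarrow> pmf t u * w s u))"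
    using fin w by (intro gibbs_inequality) (auto simp: setr t_def intro!: mult_pos_pos pmf_positive)
  also have "(\<Sum>x\<in>set_pmf r. pmf r x * log 2 (case x of (s, u) \<Rightarrow> pmf t u * w s u)) =
      (\<Sum>x\<in>set_pmf r. pmf r x * log 2 (pmf t (snd x)) + pmf r x * log 2 (w (fst x) (snd x)))"
    using w
    by (intro sum.cong refl)
       (auto simp: setr t_def log_mult_pos pmf_positive algebra_simps)
  also have "- \<dots> = entropy_pmf r snd - (\<Sum>x\<in>set_pmf r. pmf r x * log 2 (w (fst x) (snd x)))"
    using fin by (simp add: entropy_pmf_eq_expectation setr sum.distrib t)
  also have "\<dots> \<le> entropy_pmf r snd +
     (\<Sum>x\<in>set_pmf r. pmf r x * (- log 2 (1 - \<delta>)) +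
        (if snd x \<noteq> fst x then pmf r x else 0) * (log 2 N - log 2 \<delta>))"
  proof -
    \<comment> \<open>The nonnegative charge \<open>- log 2 (1 - \<delta>)\<close> may be levied on
      every pair, the charge \<open>log 2 N - log 2 \<delta>\<close> only on mismatches; the
      mismatches then sum to the error probability.\<close>
    have "log 2 (1 - \<delta>) \<le> 0" using \<delta> by simp
    then have "- (pmf r x * log 2 (w (fst x) (snd x))) \<le> pmf r x * (- log 2 (1 - \<delta>)) +
        (if snd x \<noteq> fst x then pmf r x else 0) * (log 2 N - log 2 \<delta>)" for x
      using \<delta> N mult_nonneg_nonpos[of "pmf r x" "log 2 (1 - \<delta>)"]
      by (auto simp: w_def log_divide_pos algebra_simps)
    then show ?thesis by (simp add: sum_negf[symmetric] sum_mono)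
  qed
  also have "\<dots> = entropy_pmf r snd - log 2 (1 - \<delta>) +
      measure_pmf.prob r {x. snd x \<noteq> fst x} * (log 2 N - log 2 \<delta>)"
  proof -
    have "measure_pmf.prob r {x. snd x \<noteq> fst x} =
        measure_pmf.prob r ({x. snd x \<noteq> fst x} \<inter> set_pmf r)"
      by (simp add: measure_Int_set_pmf)
    also have "\<dots> = measure_pmf.prob r {x \<in> set_pmf r. snd x \<noteq> fst x}"
      by (rule arg_cong[where f = "measure_pmf.prob r"]) auto
    also have "\<dots> = (\<Sum>x\<in>set_pmf r. if snd x \<noteq> fst x then pmf r x else 0)"
      using fin by (simp add: measure_measure_pmf_finite setr sum.inter_filter)
    finally show ?thesis
      using fin unfolding sum.distrib sum_distrib_right[symmetric]
      by (simp add: sum_pmf_eq_1 setr)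
  qed
  also have "measure_pmf.prob r {x. snd x \<noteq> fst x} = measure_pmf.prob p {v. T v \<noteq> S v}"
    by (simp add: r_def vimage_def)
  also have "\<dots> * (log 2 N - log 2 \<delta>) \<le> \<delta> * (log 2 N - log 2 \<delta>)"
  proof -
    have "log 2 \<delta> \<le> 0" "0 \<le> log 2 N" using \<delta> N by simp_all
    then show ?thesis using err by (intro mult_right_mono) auto
  qed
  finally show ?thesis using fin by (simp add: r_def entropy_pmf_map)
qed

text \<open>By \<open>K\<close>, the law of \<open>h\<close> given \<open>s\<close> depends on
  \<open>s\<close> only through \<open>V s\<close>. Any representative therefore defines a kernel on
  the values of \<open>V\<close>, to which the chain rule applies. Keeping the average over
  \<open>q\<close> makes the conditional term literally the same for different choices of
  \<open>V\<close>, so that it cancels later.\<close>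

lemma entropy_pmf_kernel:
  assumes fin: "finite (set_pmf q)" "\<And>s. s \<in> set_pmf q \<Longrightarrow> finite (set_pmf (K s))"
    and K: "\<And>s t. s \<in> set_pmf q \<Longrightarrow> t \<in> set_pmf q \<Longrightarrow> V s = V t \<Longrightarrow> map_pmf h (K s) = map_pmf h (K t)"
  shows "entropy_pmf (bind_pmf q (\<lambda>s. map_pmf (Pair s) (K s))) (\<lambda>(s, k). (V s, h k)) =
    entropy_pmf q V + measure_pmf.expectation q (\<lambda>s. entropy_pmf (K s) h)"
proof -
  define L where "L v = map_pmf h (K (SOME s. s \<in> set_pmf q \<and> V s = v))" for v
  have L: "L (V s) = map_pmf h (K s)" if "s \<in> set_pmf q" for s
  proof -
    have "(SOME t. t \<in> set_pmf q \<and> V t = V s) \<in> set_pmf q \<and> V (SOME t. t \<in> set_pmf q \<and> V t = V s) = V s"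
      using that by (intro someI[of "\<lambda>t. t \<in> set_pmf q \<and> V t = V s" s]) simp
    then show ?thesis unfolding L_def using K that by blast
  qed
  let ?p = "bind_pmf q (\<lambda>s. map_pmf (Pair s) (K s))"
  have "map_pmf (\<lambda>(s, k). (V s, h k)) ?p = bind_pmf q (\<lambda>s. map_pmf (Pair (V s)) (L (V s)))"
    unfolding map_bind_pmf by (intro bind_pmf_cong refl) (simp add: L map_pmf_comp)
  also have "\<dots> = bind_pmf (map_pmf V q) (\<lambda>v. map_pmf (Pair v) (L v))"
    by (simp add: bind_map_pmf)
  finally have p: "map_pmf (\<lambda>(s, k). (V s, h k)) ?p = bind_pmf (map_pmf V q) (\<lambda>v. map_pmf (Pair v) (L v))" .
  have "entropy_pmf ?p (\<lambda>(s, k). (V s, h k)) = entropy_pmf (map_pmf (\<lambda>(s, k). (V s, h k)) ?p) (\<lambda>w. w)"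
    using fin by (subst entropy_pmf_map) auto
  also have "\<dots> = entropy_pmf (map_pmf V q) (\<lambda>v. v) +
      measure_pmf.expectation (map_pmf V q) (\<lambda>v. entropy_pmf (L v) (\<lambda>w. w))"
    unfolding p using fin by (intro entropy_pmf_bind_Pair) (auto simp: L)
  also have "\<dots> = entropy_pmf q V + measure_pmf.expectation q (\<lambda>s. entropy_pmf (L (V s)) (\<lambda>w. w))"
    using fin by (simp add: entropy_pmf_map)
  also have "measure_pmf.expectation q (\<lambda>s. entropy_pmf (L (V s)) (\<lambda>w. w)) =
      measure_pmf.expectation q (\<lambda>s. entropy_pmf (K s) h)"
    using fin by (intro integral_cong_AE) (auto simp: AE_measure_pmf_iff L entropy_pmf_map)
  finally show ?thesis .
qed

section \<open>Conditional mutual information of three coordinates\<close>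

text \<open>I(A; B | E) is spelled out in entropies so that every information inequality below
  becomes linear arithmetic over entropy identities and submodularity.\<close>

definition triple_cmi :: "('a \<times> 'b \<times> 'c) pmf \<Rightarrow> real" where
  "triple_cmi p = entropy_pmf p (\<lambda>(a, b, e). (a, e)) + entropy_pmf p (\<lambda>(a, b, e). (b, e)) -
     entropy_pmf p (\<lambda>w. w) - entropy_pmf p (\<lambda>(a, b, e). e)"

lemma channel_cmi_eq_triple_cmi:
  fixes W :: "('x::finite, 'y::finite, 'z::finite) dmbc"
  shows "channel_cmi W P = triple_cmi (channel_joint W P)"
  unfolding channel_cmi_def triple_cmi_def
  by (subst cond_mutual_information_pmf_eq) (auto simp: case_prod_beta')

lemma triple_cmi_swap:
  assumes "finite (set_pmf p)"
  shows "triple_cmi (map_pmf (\<lambda>(a, b, e). (b, a, e)) p) = triple_cmi p"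
proof -
  have "entropy_pmf p (\<lambda>v. (fst (snd v), fst v, snd (snd v))) = entropy_pmf p (\<lambda>v. v)"
    using assms by (rule entropy_pmf_same_info) (auto simp: prod_eq_iff)
  then show ?thesis
    using assms by (simp add: triple_cmi_def entropy_pmf_map case_prod_beta')
qed

text \<open>Allows views to be handled as nested pairs in the estimates and repackaged as lists
  afterwards.\<close>

lemma triple_cmi_map_inj:
  assumes "finite (set_pmf p)" and "inj f" and "inj g" and "inj h"
  shows "triple_cmi (map_pmf (\<lambda>(a, b, e). (f a, g b, h e)) p) = triple_cmi p"
proof -
  have "entropy_pmf p (\<lambda>v. (f (fst v), h (snd (snd v)))) = entropy_pmf p (\<lambda>v. (fst v, snd (snd v)))"
    and "entropy_pmf p (\<lambda>v. (g (fst (snd v)), h (snd (snd v)))) = entropy_pmf p (\<lambda>v. snd v)"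
    and "entropy_pmf p (\<lambda>v. (f (fst v), g (fst (snd v)), h (snd (snd v)))) = entropy_pmf p (\<lambda>v. v)"
    and "entropy_pmf p (\<lambda>v. h (snd (snd v))) = entropy_pmf p (\<lambda>v. snd (snd v))"
    using assms by (auto intro!: entropy_pmf_same_info simp: inj_eq prod_eq_iff)
  then show ?thesis
    using assms by (simp add: triple_cmi_def entropy_pmf_map case_prod_beta')
qed

text \<open>Data processing: the difference of the two sides is I(A; B | f A, E), nonnegative by
  submodularity.\<close>

lemma triple_cmi_map_fst_le:
  assumes fin: "finite (set_pmf p)"
  shows "triple_cmi (map_pmf (\<lambda>(a, b, e). (f a, b, e)) p) \<le> triple_cmi p"
proof -
  have "entropy_pmf p (\<lambda>v. (fst v, fst (snd v), f (fst v), snd (snd v))) = entropy_pmf p (\<lambda>v. v)"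
    and "entropy_pmf p (\<lambda>v. (fst v, f (fst v), snd (snd v))) = entropy_pmf p (\<lambda>v. (fst v, snd (snd v)))"
    and "entropy_pmf p (\<lambda>v. (fst (snd v), f (fst v), snd (snd v))) = entropy_pmf p (\<lambda>v. (f (fst v), snd v))"
    by (rule entropy_pmf_same_info[OF fin]; auto simp: prod_eq_iff)+
  with entropy_pmf_submodular[OF fin, of fst "\<lambda>v. fst (snd v)" "\<lambda>v. (f (fst v), snd (snd v))"]
  show ?thesis
    using fin by (simp add: triple_cmi_def entropy_pmf_map case_prod_beta')
qed

lemma triple_cmi_map_le:
  assumes fin: "finite (set_pmf p)"
  shows "triple_cmi (map_pmf (\<lambda>(a, b, e). (f a, g b, e)) p) \<le> triple_cmi p"
proof -
  let ?swap = "map_pmf (\<lambda>(a, b, e). (b, a, e))"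
  let ?r = "map_pmf (\<lambda>(a, b, e). (f a, b, e)) p"
  have "triple_cmi (map_pmf (\<lambda>(a, b, e). (f a, g b, e)) p) =
      triple_cmi (?swap (map_pmf (\<lambda>(a, b, e). (g a, b, e)) (?swap ?r)))"
    by (simp add: map_pmf_comp case_prod_beta')
  also have "\<dots> = triple_cmi (map_pmf (\<lambda>(a, b, e). (g a, b, e)) (?swap ?r))"
    using fin by (intro triple_cmi_swap) simp
  also have "\<dots> \<le> triple_cmi (?swap ?r)"
    using fin by (intro triple_cmi_map_fst_le) simp
  also have "\<dots> = triple_cmi ?r" using fin by (intro triple_cmi_swap) simp
  also have "\<dots> \<le> triple_cmi p" by (rule triple_cmi_map_fst_le[OF fin])
  finally show ?thesis .
qed

section \<open>Local randomness, channel uses and whole rounds\<close>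

text \<open>The new variable is drawn from \<open>a\<close> alone, so its entropy given (A, E)
  equals that given (A, B, E). Both are the mean entropy of \<open>K a\<close>, and they enter with
  opposite signs.\<close>

lemma triple_cmi_local_randomness:
  assumes fin: "finite (set_pmf q)" "\<And>s. s \<in> set_pmf q \<Longrightarrow> finite (set_pmf (K (fst s)))"
  shows "triple_cmi (bind_pmf q (\<lambda>(a, b, e). map_pmf (\<lambda>x. ((a, x), b, e)) (K a))) = triple_cmi q"
proof -
  define r where "r = bind_pmf q (\<lambda>s. map_pmf (Pair s) (K (fst s)))"
  have finr: "finite (set_pmf r)" using fin by (simp add: r_def)
  have p: "bind_pmf q (\<lambda>(a, b, e). map_pmf (\<lambda>x. ((a, x), b, e)) (K a)) =
      map_pmf (\<lambda>((a, b, e), x). ((a, x), b, e)) r"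
    by (simp add: r_def map_bind_pmf map_pmf_comp case_prod_beta')
  have fst_r: "map_pmf fst r = q"
    by (simp add: r_def map_bind_pmf map_pmf_comp map_pmf_const bind_return_pmf')
  have old: "entropy_pmf r (\<lambda>v. X (fst v)) = entropy_pmf q X" for X :: "_ \<Rightarrow> 'u"
    using entropy_pmf_map[OF finr, of fst X] by (simp add: fst_r)
  have "entropy_pmf r (\<lambda>v. ((fst (fst v), snd v), snd (snd (fst v)))) =
      entropy_pmf r (\<lambda>(s, k). ((fst s, snd (snd s)), k))"
    and "entropy_pmf r (\<lambda>v. ((fst (fst v), snd v), fst (snd (fst v)), snd (snd (fst v)))) =
      entropy_pmf r (\<lambda>(s, k). (s, k))"
    by (rule entropy_pmf_same_info[OF finr]; auto simp: prod_eq_iff)+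
  moreover have "entropy_pmf r (\<lambda>(s, k). ((fst s, snd (snd s)), k)) = entropy_pmf q (\<lambda>s. (fst s, snd (snd s))) +
       measure_pmf.expectation q (\<lambda>s. entropy_pmf (K (fst s)) (\<lambda>k. k))"
    "entropy_pmf r (\<lambda>(s, k). (s, k)) = entropy_pmf q (\<lambda>s. s) +
       measure_pmf.expectation q (\<lambda>s. entropy_pmf (K (fst s)) (\<lambda>k. k))"
    unfolding r_def using fin by (intro entropy_pmf_kernel; simp)+
  ultimately show ?thesis
    unfolding p using finr old[of "\<lambda>v. snd v"] old[of "\<lambda>v. snd (snd v)"]
    by (simp add: triple_cmi_def entropy_pmf_map case_prod_beta')
qed

text \<open>Put X = f A. As the outputs depend on the past only through X, H(Y, Z | A, B, E) = H(Y,
  Z | X) and H(Z | A, E) = H(Z | X), and these cancel against the same terms of I(X; Y | Z). The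
  slack that remains is exactly I(B, E; Y | Z) + I(B; Z | E).\<close>

lemma triple_cmi_channel_use:
  fixes W :: "('x::finite, 'y::finite, 'z::finite) dmbc"
  assumes fin: "finite (set_pmf q)"
  shows "triple_cmi (bind_pmf q (\<lambda>(a, b, e). map_pmf (\<lambda>(y, z). (a, (b, y), (e, z))) (W (f a))))
    \<le> triple_cmi q + channel_cmi W (map_pmf (\<lambda>(a, b, e). f a) q)"
proof -
  define r where "r = bind_pmf q (\<lambda>s. map_pmf (Pair s) (W (f (fst s))))"
  have finr: "finite (set_pmf r)" using fin by (simp add: r_def)
  have p: "bind_pmf q (\<lambda>(a, b, e). map_pmf (\<lambda>(y, z). (a, (b, y), (e, z))) (W (f a))) =
      map_pmf (\<lambda>((a, b, e), (y, z)). (a, (b, y), (e, z))) r"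
    by (simp add: r_def map_bind_pmf map_pmf_comp case_prod_beta')
  have j: "channel_joint W (map_pmf (\<lambda>(a, b, e). f a) q) = map_pmf (\<lambda>((a, b, e), (y, z)). (f a, y, z)) r"
    by (simp add: r_def channel_joint_def bind_map_pmf map_bind_pmf map_pmf_comp case_prod_beta'
          map_pmf_def[symmetric])
  have fst_r: "map_pmf fst r = q"
    by (simp add: r_def map_bind_pmf map_pmf_comp map_pmf_const bind_return_pmf')
  have old: "entropy_pmf r (\<lambda>v. X (fst v)) = entropy_pmf q X" for X :: "_ \<Rightarrow> 'u"
    using entropy_pmf_map[OF finr, of fst X] by (simp add: fst_r)
  let ?A = "\<lambda>v. fst (fst v)" and ?B = "\<lambda>v. fst (snd (fst v))" and ?E = "\<lambda>v. snd (snd (fst v))"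
  let ?X = "\<lambda>v. f (fst (fst v))" and ?Y = "\<lambda>v. fst (snd v)" and ?Z = "\<lambda>v. snd (snd v)"
  let ?k = "measure_pmf.expectation q (\<lambda>s. entropy_pmf (W (f (fst s))) (\<lambda>k. k))"
  let ?l = "measure_pmf.expectation q (\<lambda>s. entropy_pmf (W (f (fst s))) snd)"
  let ?H = "entropy_pmf r"
  \<comment> \<open>\<open>?k\<close> is H(Y, Z | X) and \<open>?l\<close> is H(Z | X).\<close>
  have kernel: "?H (\<lambda>(s, k). (s, k)) = entropy_pmf q (\<lambda>s. s) + ?k"
      "?H (\<lambda>(s, k). ((fst s, snd (snd s)), snd k)) = entropy_pmf q (\<lambda>s. (fst s, snd (snd s))) + ?l"
      "?H (\<lambda>(s, k). (f (fst s), k)) = entropy_pmf q (\<lambda>s. f (fst s)) + ?k"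
      "?H (\<lambda>(s, k). (f (fst s), snd k)) = entropy_pmf q (\<lambda>s. f (fst s)) + ?l"
    unfolding r_def using fin by (intro entropy_pmf_kernel; simp)+
  have same: "?H (\<lambda>v. (?A v, (?B v, ?Y v), ?E v, ?Z v)) = ?H (\<lambda>(s, k). (s, k))"
    "?H (\<lambda>v. (?A v, ?E v, ?Z v)) = ?H (\<lambda>(s, k). ((fst s, snd (snd s)), snd k))"
    "?H (\<lambda>v. ((?B v, ?Y v), ?E v, ?Z v)) = ?H (\<lambda>v. ((?B v, ?E v), ?Y v, ?Z v))"
    "?H (\<lambda>v. (?B v, ?Z v, ?E v)) = ?H (\<lambda>v. ((?B v, ?E v), ?Z v))"
    "?H (\<lambda>v. (?Z v, ?E v)) = ?H (\<lambda>v. (?E v, ?Z v))"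
    by (rule entropy_pmf_same_info[OF finr]; auto simp: prod_eq_iff)+
  have "?H (\<lambda>v. ((?B v, ?E v), ?Y v, ?Z v)) + ?H ?Z \<le> ?H (\<lambda>v. ((?B v, ?E v), ?Z v)) + ?H (\<lambda>v. (?Y v, ?Z v))"
    "?H (\<lambda>v. (?B v, ?Z v, ?E v)) + ?H ?E \<le> ?H (\<lambda>v. (?B v, ?E v)) + ?H (\<lambda>v. (?Z v, ?E v))"
    by (rule entropy_pmf_submodular[OF finr])+
  then show ?thesis
    unfolding p channel_cmi_eq_triple_cmi j
    using finr kernel same old[of "\<lambda>v. snd v"] old[of "\<lambda>v. snd (snd v)"]
    by (simp add: triple_cmi_def entropy_pmf_map case_prod_beta')
qed

text \<open>For the induction on the block length, the outputs already received in the block are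
  carried as accumulators \<open>ys\<close> and \<open>zs\<close>. The coordinate \<open>a\<close>
  stays fixed, since it already determines the whole word; only the function \<open>f\<close>
  reading the remaining word changes, from \<open>f\<close> to its tail.\<close>

lemma triple_cmi_transmit_accumulate:
  fixes W :: "('x::finite, 'y::finite, 'z::finite) dmbc"
  assumes C: "\<And>P. channel_cmi W P \<le> C"
    and "finite (set_pmf q)" and "\<And>s. s \<in> set_pmf q \<Longrightarrow> length (f (fst s)) = n"
  shows "triple_cmi (bind_pmf q (\<lambda>(a, (b, ys), (e, zs)).
      map_pmf (\<lambda>yzs. (a, (b, ys @ map fst yzs), (e, zs @ map snd yzs))) (transmit W (f a))))
    \<le> triple_cmi q + real n * C"
  using assms(2,3)
proof (induction n arbitrary: q f)
  case 0
  have "bind_pmf q (\<lambda>(a, (b, ys), (e, zs)).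
      map_pmf (\<lambda>yzs. (a, (b, ys @ map fst yzs), (e, zs @ map snd yzs))) (transmit W (f a))) =
      bind_pmf q return_pmf"
    using 0(2) by (intro bind_pmf_cong refl) auto
  then show ?case by (simp add: bind_return_pmf')
next
  case (Suc n)
  define r where "r = bind_pmf q (\<lambda>(a, b, e). map_pmf (\<lambda>(y, z). (a, (b, y), (e, z))) (W (hd (f a))))"
  \<comment> \<open>The newest symbols move to the ends of the accumulators. This repackaging is
    injective and hence costs nothing.\<close>
  define q' where "q' = map_pmf (\<lambda>(a, b, e). (id a, (\<lambda>((b, ys), y). (b, ys @ [y])) b, (\<lambda>((e, zs), z). (e, zs @ [z])) e)) r"
  have finr: "finite (set_pmf r)" using Suc.prems(1) by (auto simp: r_def)
  have q': "q' = bind_pmf q (\<lambda>(a, (b, ys), (e, zs)).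
      map_pmf (\<lambda>(y, z). (a, (b, ys @ [y]), (e, zs @ [z]))) (W (hd (f a))))"
    by (simp add: q'_def r_def map_bind_pmf map_pmf_comp case_prod_beta')
  have "bind_pmf q (\<lambda>(a, (b, ys), (e, zs)).
      map_pmf (\<lambda>yzs. (a, (b, ys @ map fst yzs), (e, zs @ map snd yzs))) (transmit W (f a))) =
    bind_pmf q' (\<lambda>(a, (b, ys), (e, zs)).
      map_pmf (\<lambda>yzs. (a, (b, ys @ map fst yzs), (e, zs @ map snd yzs))) (transmit W (tl (f a))))"
    unfolding q' bind_assoc_pmf
  proof (intro bind_pmf_cong refl)
    fix s assume "s \<in> set_pmf q"
    then obtain x xs where "f (fst s) = x # xs"
      using Suc.prems(2) by (metis length_Suc_conv)
    then show "(\<lambda>(a, (b, ys), (e, zs)).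
        map_pmf (\<lambda>yzs. (a, (b, ys @ map fst yzs), (e, zs @ map snd yzs))) (transmit W (f a))) s =
      (\<lambda>(a, (b, ys), (e, zs)).
        map_pmf (\<lambda>(y, z). (a, (b, ys @ [y]), (e, zs @ [z]))) (W (hd (f a)))) s \<bind>
      (\<lambda>(a, (b, ys), (e, zs)).
        map_pmf (\<lambda>yzs. (a, (b, ys @ map fst yzs), (e, zs @ map snd yzs))) (transmit W (tl (f a))))"
      by (cases s) (auto simp: bind_map_pmf map_bind_pmf case_prod_beta' map_pmf_def[symmetric] map_pmf_comp)
  qed
  also have "triple_cmi \<dots> \<le> triple_cmi q' + real n * C"
  proof (rule Suc.IH[of q' "\<lambda>a. tl (f a)"])
    show "finite (set_pmf q')" using finr by (simp add: q'_def)
    fix s assume "s \<in> set_pmf q'"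
    then show "length (tl (f (fst s))) = n"
      using Suc.prems(2) by (fastforce simp: q')
  qed
  also have "triple_cmi q' = triple_cmi r"
    unfolding q'_def by (intro triple_cmi_map_inj finr) (auto simp: inj_on_def)
  also have "\<dots> \<le> triple_cmi q + channel_cmi W (map_pmf (\<lambda>(a, b, e). hd (f a)) q)"
    unfolding r_def using Suc.prems(1) by (rule triple_cmi_channel_use)
  finally show ?case
    using C[of "map_pmf (\<lambda>(a, b, e). hd (f a)) q"] by (simp add: algebra_simps)
qed

lemma triple_cmi_transmit:
  fixes W :: "('x::finite, 'y::finite, 'z::finite) dmbc"
  assumes C: "\<And>P. channel_cmi W P \<le> C"
    and fin: "finite (set_pmf q)" and len: "\<And>s. s \<in> set_pmf q \<Longrightarrow> length (f (fst s)) = n"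
  shows "triple_cmi (bind_pmf q (\<lambda>(a, b, e).
      map_pmf (\<lambda>yzs. (a, (b, map fst yzs), (e, map snd yzs))) (transmit W (f a))))
    \<le> triple_cmi q + real n * C"
proof -
  let ?q = "map_pmf (\<lambda>(a, b, e). (id a, (b, [] :: 'y list), (e, [] :: 'z list))) q"
  have "triple_cmi ?q = triple_cmi q"
    by (intro triple_cmi_map_inj fin) (auto simp: inj_on_def)
  moreover have "triple_cmi (bind_pmf ?q (\<lambda>(a, (b, ys), (e, zs)).
      map_pmf (\<lambda>yzs. (a, (b, ys @ map fst yzs), (e, zs @ map snd yzs))) (transmit W (f a))))
    \<le> triple_cmi ?q + real n * C"
    by (rule triple_cmi_transmit_accumulate) (use C fin len in auto)
  ultimately show ?thesis by (simp add: bind_map_pmf case_prod_beta')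
qed

text \<open>The round is split in two: adjoining the drawn word to the sender's coordinate is free,
  and afterwards the word to transmit is a function of that coordinate.\<close>

lemma triple_cmi_round:
  fixes W :: "('x::finite, 'y::finite, 'z::finite) dmbc"
  assumes C: "\<And>P. channel_cmi W P \<le> C"
    and fin: "finite (set_pmf q)" and len: "\<And>a xs. xs \<in> set_pmf (enc a) \<Longrightarrow> length xs = n"
  shows "triple_cmi (bind_pmf q (\<lambda>(a, b, e). bind_pmf (enc a) (\<lambda>xs.
      map_pmf (\<lambda>yzs. ((a, xs), (b, map fst yzs), (e, map snd yzs))) (transmit W xs))))
    \<le> triple_cmi q + real n * C"
proof -
  define r where "r = bind_pmf q (\<lambda>(a, b, e). map_pmf (\<lambda>x. ((a, x), b, e)) (enc a))"
  have finenc: "finite (set_pmf (enc a))" for a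
    using len by (intro finite_subset[OF _ finite_lists_length_eq[of "UNIV :: 'x set" n]]) auto
  have "triple_cmi (bind_pmf q (\<lambda>(a, b, e). bind_pmf (enc a) (\<lambda>xs.
      map_pmf (\<lambda>yzs. ((a, xs), (b, map fst yzs), (e, map snd yzs))) (transmit W xs)))) =
    triple_cmi (bind_pmf r (\<lambda>(a, b, e).
      map_pmf (\<lambda>yzs. (a, (b, map fst yzs), (e, map snd yzs))) (transmit W (snd a))))"
    by (simp add: r_def bind_map_pmf bind_assoc_pmf case_prod_beta')
  also have "\<dots> \<le> triple_cmi r + real n * C"
    using fin finenc len by (intro triple_cmi_transmit C) (auto simp: r_def)
  also have "triple_cmi r = triple_cmi q"
    unfolding r_def using fin finenc by (rule triple_cmi_local_randomness)
  finally show ?thesis .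
qed

text \<open>Joint masses are at most marginal masses, so H(X | Y) >= 0.\<close>

lemma entropy_pmf_le_Pair:
  assumes "finite (set_pmf p)"
  shows "entropy_pmf p Y \<le> entropy_pmf p (\<lambda>v. (X v, Y v))"
proof -
  have "pmf p v * log 2 (pmf (map_pmf (\<lambda>v. (X v, Y v)) p) (X v, Y v)) \<le>
      pmf p v * log 2 (pmf (map_pmf Y p) (Y v))" if "v \<in> set_pmf p" for v
  proof -
    have "pmf (map_pmf (\<lambda>v. (X v, Y v)) p) (X v, Y v) \<le> pmf (map_pmf Y p) (Y v)"
      unfolding pmf_map by (intro measure_pmf.finite_measure_mono) auto
    then show ?thesis using that by (intro mult_left_mono) (auto simp: pmf_positive)
  qed
  then show ?thesis using assms by (simp add: entropy_pmf_eq_expectation sum_mono)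
qed

section \<open>Support sizes and accumulation over the rounds\<close>

lemma length_transmit: "yzs \<in> set_pmf (transmit W xs) \<Longrightarrow> length yzs = length xs"
  by (induction xs arbitrary: yzs) auto

lemma card_lists_length:
  "finite {xs :: 'a::finite list. length xs = n}" "card {xs :: 'a::finite list. length xs = n} = CARD('a) ^ n"
  using finite_lists_length_eq[of "UNIV :: 'a set" n] card_lists_length_eq[of "UNIV :: 'a set" n] by simp_all

text \<open>An outcome is determined by the sent word and the word of output pairs, both of length
  \<open>n\<close>. The count later bounds the number of key values in Fano's inequality.\<close>

lemma card_set_pmf_round:
  fixes W :: "('x::finite, 'y::finite, 'z::finite) dmbc"
  assumes "\<And>xs. xs \<in> set_pmf p \<Longrightarrow> length xs = n"
  shows "finite (set_pmf (bind_pmf p (\<lambda>xs. map_pmf (f xs) (transmit W xs))))"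
    and "card (set_pmf (bind_pmf p (\<lambda>xs. map_pmf (f xs) (transmit W xs)))) \<le> CARD('x \<times> 'y \<times> 'z) ^ n"
proof -
  let ?L = "{xs :: 'x list. length xs = n} \<times> {yzs :: ('y \<times> 'z) list. length yzs = n}"
  have sub: "set_pmf (bind_pmf p (\<lambda>xs. map_pmf (f xs) (transmit W xs))) \<subseteq> (\<lambda>(xs, yzs). f xs yzs) ` ?L"
    using assms by (force simp: length_transmit)
  have L: "finite ?L" by (simp add: card_lists_length)
  show "finite (set_pmf (bind_pmf p (\<lambda>xs. map_pmf (f xs) (transmit W xs))))"
    using sub L by (rule finite_surj[rotated])
  have "card (set_pmf (bind_pmf p (\<lambda>xs. map_pmf (f xs) (transmit W xs)))) \<le> card ?L"
    using L sub by (rule surj_card_le)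
  also have "\<dots> = CARD('x \<times> 'y \<times> 'z) ^ n"
    by (simp add: card_cartesian_product card_lists_length power_mult_distrib)
  finally show "card (set_pmf (bind_pmf p (\<lambda>xs. map_pmf (f xs) (transmit W xs)))) \<le> CARD('x \<times> 'y \<times> 'z) ^ n" .
qed

lemma card_set_pmf_run_round:
  fixes Wf :: "('xf::finite, 'yf::finite, 'zf::finite) dmbc"
    and Wb :: "('xb::finite, 'yb::finite, 'zb::finite) dmbc"
  assumes "valid_round r"
    and "CARD('xf \<times> 'yf \<times> 'zf) \<le> K" "CARD('xb \<times> 'yb \<times> 'zb) \<le> K"
  shows "finite (set_pmf (run_round Wf Wb r v)) \<and>
    card (set_pmf (run_round Wf Wb r v)) \<le> K ^ (forward_uses r + backward_uses r)"
proof (cases v)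
  case v: (fields a b e)
  show ?thesis
  proof (cases r)
    case r: (Forward n enc)
    have len: "\<And>xs. xs \<in> set_pmf (enc a) \<Longrightarrow> length xs = n" using assms(1) by (simp add: r)
    have "CARD('xf \<times> 'yf \<times> 'zf) ^ n \<le> K ^ n" using assms(2) by (rule power_mono) simp
    then show ?thesis
      using card_set_pmf_round[of "enc a" n
          "\<lambda>xs yzs. (a @ [Inl xs], b @ [Inl (map fst yzs)], e @ [Inl (map snd yzs)])" Wf, OF len]
      by (simp add: r v map_pmf_def)
  next
    case r: (Backward n enc)
    have len: "\<And>xs. xs \<in> set_pmf (enc b) \<Longrightarrow> length xs = n" using assms(1) by (simp add: r)
    have "CARD('xb \<times> 'yb \<times> 'zb) ^ n \<le> K ^ n" using assms(3) by (rule power_mono) simp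
    then show ?thesis
      using card_set_pmf_round[of "enc b" n
          "\<lambda>xs yzs. (a @ [Inr (map fst yzs)], b @ [Inr xs], e @ [Inr (map snd yzs)])" Wb, OF len]
      by (simp add: r v map_pmf_def)
  qed
qed

text \<open>Appending a tagged word to a view is injective, so a forward round reduces to
  \<open>triple_cmi_round\<close>. A backward round does so after exchanging Alice and Bob, and is
  exchanged back at the end.\<close>

lemma triple_cmi_run_round:
  fixes Wf :: "('xf::finite, 'yf::finite, 'zf::finite) dmbc"
    and Wb :: "('xb::finite, 'yb::finite, 'zb::finite) dmbc"
  assumes C: "\<And>P. channel_cmi Wf P \<le> C" "\<And>P. channel_cmi Wb P \<le> C"
    and fin: "finite (set_pmf q)" and "valid_round r"
  shows "triple_cmi (bind_pmf q (run_round Wf Wb r)) \<le>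
    triple_cmi q + real (forward_uses r + backward_uses r) * C"
proof (cases r)
  case r: (Forward n enc)
  have len: "\<And>a xs. xs \<in> set_pmf (enc a) \<Longrightarrow> length xs = n" using assms(4) by (simp add: r)
  let ?p = "bind_pmf q (\<lambda>(a, b, e). bind_pmf (enc a) (\<lambda>xs.
      map_pmf (\<lambda>yzs. ((a, xs), (b, map fst yzs), (e, map snd yzs))) (transmit Wf xs)))"
  have finp: "finite (set_pmf ?p)"
    using fin card_set_pmf_round(1)[OF len] by (auto simp del: set_bind_pmf simp: set_bind_pmf[of q])
  have "bind_pmf q (run_round Wf Wb r) = map_pmf (\<lambda>(a, b, e). ((\<lambda>(a, xs). a @ [Inl xs]) a,
      (\<lambda>(b, ys). b @ [Inl ys]) b, (\<lambda>(e, zs). e @ [Inl zs]) e)) ?p"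
    unfolding map_bind_pmf
    by (intro bind_pmf_cong refl) (auto simp: r map_bind_pmf map_pmf_comp map_pmf_def[symmetric])
  also have "triple_cmi \<dots> = triple_cmi ?p"
    by (intro triple_cmi_map_inj finp) (auto simp: inj_on_def)
  also have "\<dots> \<le> triple_cmi q + real n * C"
    by (intro triple_cmi_round C(1) fin len)
  finally show ?thesis by (simp add: r)
next
  case r: (Backward n enc)
  have len: "\<And>a xs. xs \<in> set_pmf (enc a) \<Longrightarrow> length xs = n" using assms(4) by (simp add: r)
  let ?q = "map_pmf (\<lambda>(a, b, e). (b, a, e)) q"
  let ?p = "bind_pmf ?q (\<lambda>(a, b, e). bind_pmf (enc a) (\<lambda>xs.
      map_pmf (\<lambda>yzs. ((a, xs), (b, map fst yzs), (e, map snd yzs))) (transmit Wb xs)))"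
  let ?r = "map_pmf (\<lambda>(a, b, e). (b, a, e)) ?p"
  have finp: "finite (set_pmf ?p)"
    using fin card_set_pmf_round(1)[OF len] by (auto simp del: set_bind_pmf simp: set_bind_pmf[of ?q])
  have "bind_pmf q (run_round Wf Wb r) = map_pmf (\<lambda>(a, b, e). ((\<lambda>(a, ys). a @ [Inr ys]) a,
      (\<lambda>(b, xs). b @ [Inr xs]) b, (\<lambda>(e, zs). e @ [Inr zs]) e)) ?r"
    unfolding map_bind_pmf bind_map_pmf
    by (intro bind_pmf_cong refl) (auto simp: r map_bind_pmf map_pmf_comp map_pmf_def[symmetric])
  also have "triple_cmi \<dots> = triple_cmi ?r"
    using finp by (intro triple_cmi_map_inj) (auto simp: inj_on_def)
  also have "\<dots> = triple_cmi ?p" by (rule triple_cmi_swap[OF finp])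
  also have "\<dots> \<le> triple_cmi ?q + real n * C"
    using fin by (intro triple_cmi_round C(2) len) simp
  also have "triple_cmi ?q = triple_cmi q" by (rule triple_cmi_swap[OF fin])
  finally show ?thesis by (simp add: r)
qed

lemma foldl_run_round:
  fixes Wf :: "('xf::finite, 'yf::finite, 'zf::finite) dmbc"
    and Wb :: "('xb::finite, 'yb::finite, 'zb::finite) dmbc"
  assumes C: "\<And>P. channel_cmi Wf P \<le> C" "\<And>P. channel_cmi Wb P \<le> C"
    and K: "CARD('xf \<times> 'yf \<times> 'zf) \<le> K" "CARD('xb \<times> 'yb \<times> 'zb) \<le> K"
    and "finite (set_pmf q)" and "\<forall>r\<in>set rs. valid_round r"
  shows "triple_cmi (foldl (\<lambda>p r. p \<bind> run_round Wf Wb r) q rs) \<le>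
      triple_cmi q + real (\<Sum>r\<leftarrow>rs. forward_uses r + backward_uses r) * C"
    and "card (set_pmf (foldl (\<lambda>p r. p \<bind> run_round Wf Wb r) q rs)) \<le>
      card (set_pmf q) * K ^ (\<Sum>r\<leftarrow>rs. forward_uses r + backward_uses r)"
proof -
  have "triple_cmi (foldl (\<lambda>p r. p \<bind> run_round Wf Wb r) q rs) \<le>
      triple_cmi q + real (\<Sum>r\<leftarrow>rs. forward_uses r + backward_uses r) * C \<and>
    card (set_pmf (foldl (\<lambda>p r. p \<bind> run_round Wf Wb r) q rs)) \<le>
      card (set_pmf q) * K ^ (\<Sum>r\<leftarrow>rs. forward_uses r + backward_uses r)"
    using assms(5,6)
  proof (induction rs arbitrary: q)
    case (Cons r rs)
    let ?q = "q \<bind> run_round Wf Wb r" and ?n = "forward_uses r + backward_uses r"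
    note round = card_set_pmf_run_round[of r K Wf Wb, OF _ K]
    have fin: "finite (set_pmf ?q)" using Cons.prems round by simp
    have "card (set_pmf ?q) \<le> (\<Sum>v\<in>set_pmf q. card (set_pmf (run_round Wf Wb r v)))"
      using Cons.prems(1) by (simp add: card_UN_le)
    also have "\<dots> \<le> (\<Sum>v\<in>set_pmf q. K ^ ?n)"
      using Cons.prems round by (intro sum_mono) simp
    finally have card: "card (set_pmf ?q) \<le> card (set_pmf q) * K ^ ?n" by simp
    have "triple_cmi ?q \<le> triple_cmi q + real ?n * C"
      using Cons.prems by (intro triple_cmi_run_round C) auto
    moreover have "card (set_pmf ?q) * K ^ m \<le> card (set_pmf q) * K ^ (?n + m)" for m
      using mult_right_mono[OF card, of "K ^ m"] by (simp add: power_add mult.assoc)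
    moreover have "triple_cmi (foldl (\<lambda>p r. p \<bind> run_round Wf Wb r) ?q rs) \<le>
        triple_cmi ?q + real (\<Sum>r\<leftarrow>rs. forward_uses r + backward_uses r) * C"
      and "card (set_pmf (foldl (\<lambda>p r. p \<bind> run_round Wf Wb r) ?q rs)) \<le>
        card (set_pmf ?q) * K ^ (\<Sum>r\<leftarrow>rs. forward_uses r + backward_uses r)"
      using Cons.IH[OF fin] Cons.prems(2) by simp_all
    ultimately show ?case
      unfolding foldl.simps list.map sum_list.Cons of_nat_add distrib_right
      by (intro conjI) (linarith, rule order_trans)
  qed simp
  then show "triple_cmi (foldl (\<lambda>p r. p \<bind> run_round Wf Wb r) q rs) \<le>
      triple_cmi q + real (\<Sum>r\<leftarrow>rs. forward_uses r + backward_uses r) * C"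
    and "card (set_pmf (foldl (\<lambda>p r. p \<bind> run_round Wf Wb r) q rs)) \<le>
      card (set_pmf q) * K ^ (\<Sum>r\<leftarrow>rs. forward_uses r + backward_uses r)"
    by blast+
qed

lemma final_views_bounds:
  fixes Wf :: "('xf::finite, 'yf::finite, 'zf::finite) dmbc"
    and Wb :: "('xb::finite, 'yb::finite, 'zb::finite) dmbc"
  assumes C: "\<And>P. channel_cmi Wf P \<le> C" "\<And>P. channel_cmi Wb P \<le> C"
    and K: "CARD('xf \<times> 'yf \<times> 'zf) \<le> K" "CARD('xb \<times> 'yb \<times> 'zb) \<le> K"
    and valid: "valid_protocol \<pi>"
  shows "triple_cmi (final_views Wf Wb \<pi>) \<le> real (n_f \<pi> + n_b \<pi>) * C"
    and "card (set_pmf (final_views Wf Wb \<pi>)) \<le> K ^ (n_f \<pi> + n_b \<pi>)"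
proof -
  let ?q = "return_pmf ([], [], []) :: (('xf, 'yb) view_A \<times> ('yf, 'xb) view_B \<times> ('zf, 'zb) view_E) pmf"
  have uses: "n_f \<pi> + n_b \<pi> = (\<Sum>r\<leftarrow>rounds \<pi>. forward_uses r + backward_uses r)"
    by (simp add: n_f_def n_b_def sum_list_addf)
  have "triple_cmi ?q = 0" by (simp add: triple_cmi_def entropy_pmf_eq)
  with foldl_run_round[OF C K, of ?q "rounds \<pi>"] valid
  show "triple_cmi (final_views Wf Wb \<pi>) \<le> real (n_f \<pi> + n_b \<pi>) * C"
    and "card (set_pmf (final_views Wf Wb \<pi>)) \<le> K ^ (n_f \<pi> + n_b \<pi>)"
    unfolding uses by (simp_all add: final_views_def valid_protocol_def)
qed

section \<open>Equivocation of the key and the bound on achievable rates\<close>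

text \<open>With S = f A and T = g B, H(S | E) = I(S; T | E) + H(S | T, E). Data processing bounds
  the first term by I(A; B | E), and dropping E from the conditioning bounds the second by H(S |
  T).\<close>

lemma equivocation_le:
  assumes fin: "finite (set_pmf p)"
  shows "entropy_pmf p (\<lambda>(a, b, e). (f a, e)) - entropy_pmf p (\<lambda>(a, b, e). e) \<le>
    triple_cmi p + (entropy_pmf p (\<lambda>(a, b, e). (f a, g b)) - entropy_pmf p (\<lambda>(a, b, e). g b))"
proof -
  have "entropy_pmf p (\<lambda>v. (f (fst v), snd (snd v), g (fst (snd v)))) =
      entropy_pmf p (\<lambda>v. (f (fst v), g (fst (snd v)), snd (snd v)))"
    and "entropy_pmf p (\<lambda>v. (snd (snd v), g (fst (snd v)))) = entropy_pmf p (\<lambda>v. (g (fst (snd v)), snd (snd v)))"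
    by (rule entropy_pmf_same_info[OF fin]; auto)+
  with entropy_pmf_submodular[OF fin, of "\<lambda>v. f (fst v)" "\<lambda>v. snd (snd v)" "\<lambda>v. g (fst (snd v))"]
    triple_cmi_map_le[OF fin, of f g]
  show ?thesis
    using fin by (simp add: triple_cmi_def entropy_pmf_map case_prod_beta')
qed

lemma key_equivocation_le:
  fixes Wf :: "('xf::finite, 'yf::finite, 'zf::finite) dmbc"
    and Wb :: "('xb::finite, 'yb::finite, 'zb::finite) dmbc"
  assumes "valid_protocol \<pi>"
  defines "V \<equiv> final_views Wf Wb \<pi>"
  shows "cond_entropy_pmf V (key \<pi>) eve_view \<le>
    triple_cmi V + (entropy_pmf V (\<lambda>v. (key \<pi> v, key_estimate \<pi> v)) - entropy_pmf V (key_estimate \<pi>))"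
proof -
  have fin: "finite (set_pmf V)" unfolding V_def using assms(1) by (rule finite_set_pmf_final_views)
  show ?thesis
  proof (cases "key_by_alice \<pi>")
    case True
    then show ?thesis
      using equivocation_le[OF fin, of "output_A \<pi>" "output_B \<pi>"]
      by (simp add: cond_entropy_pmf_eq[OF fin] key_def key_estimate_def eve_view_def case_prod_beta')
  next
    case False
    \<comment> \<open>When Bob computes the key, the exchanged triple puts the key holder
      first.\<close>
    let ?V = "map_pmf (\<lambda>(a, b, e). (b, a, e)) V"
    have "finite (set_pmf ?V)" using fin by simp
    from equivocation_le[OF this, of "output_B \<pi>" "output_A \<pi>"] False show ?thesis
      using fin triple_cmi_swap[OF fin]
      by (simp add: cond_entropy_pmf_eq entropy_pmf_map key_def key_estimate_def eve_view_def
          case_prod_beta')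
  qed
qed

text \<open>The number of channel uses may grow without control as \<open>\<delta>\<close> shrinks,
  so the estimate per use must depend on \<open>\<delta>\<close> only before the limit is
  taken.\<close>

lemma achievable_rate_le:
  fixes Wf :: "('xf::finite, 'yf::finite, 'zf::finite) dmbc"
    and Wb :: "('xb::finite, 'yb::finite, 'zb::finite) dmbc"
  assumes C: "\<And>P. channel_cmi Wf P \<le> C" "\<And>P. channel_cmi Wb P \<le> C"
    and R: "achievable_rate Wf Wb R"
  shows "R \<le> C"
proof -
  define K where "K = max (CARD('xf \<times> 'yf \<times> 'zf)) (CARD('xb \<times> 'yb \<times> 'zb))"
  have K: "CARD('xf \<times> 'yf \<times> 'zf) \<le> K" "CARD('xb \<times> 'yb \<times> 'zb) \<le> K"
    by (simp_all only: K_def max.cobounded1 max.cobounded2)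
  have Kpos: "0 < K" using K(1) zero_less_card_finite[where 'a = "'xf \<times> 'yf \<times> 'zf"] by linarith
  \<comment> \<open>Fano's penalty for \<open>N = K\<close>; it dominates the penalty per use for
    \<open>N = K ^ n\<close> whenever \<open>n\<close> is at least 1.\<close>
  define \<phi> where "\<phi> \<delta> = - log 2 (1 - \<delta>) + \<delta> * (log 2 K - log 2 \<delta>)" for \<delta> :: real
  have bound: "(1 - \<delta>) * (R - \<delta>) \<le> C + \<phi> \<delta>" if \<delta>: "0 < \<delta>" "\<delta> < 1" for \<delta>
  proof -
    obtain \<pi> :: "('xf, 'yf, 'xb, 'yb) ske_protocol"
      where valid: "valid_protocol \<pi>" and secure: "secure_ske Wf Wb R \<delta> \<pi>"
      using R \<delta> unfolding achievable_rate_def by auto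
    define V where "V = final_views Wf Wb \<pi>"
    define n where "n = n_f \<pi> + n_b \<pi>"
    define H where "H = entropy_pmf V (key \<pi>)"
    have fin: "finite (set_pmf V)" unfolding V_def using valid by (rule finite_set_pmf_final_views)
    have n: "1 \<le> real n" using valid by (auto simp: valid_protocol_def n_def)
    have rate: "R - \<delta> < H / n"
      and err: "measure_pmf.prob V {v. key_estimate \<pi> v \<noteq> key \<pi> v} \<le> \<delta>"
      and eq: "H = 0 \<or> 1 - \<delta> < cond_entropy_pmf V (key \<pi>) eve_view / H"
      using secure unfolding secure_ske_def Let_def V_def[symmetric] n_def[symmetric] H_def[symmetric]
      by auto
    have "0 \<le> H"
      unfolding H_def using fin
      by (auto simp: entropy_pmf_eq pmf_le_1 sum_nonpos mult_nonneg_nonpos pmf_positive)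
    have nonneg: "0 \<le> cond_entropy_pmf V (key \<pi>) eve_view"
      using fin by (simp add: cond_entropy_pmf_eq entropy_pmf_le_Pair)
    \<comment> \<open>For \<open>H = 0\<close> the secrecy condition says nothing about the ratio,
      and nonnegativity of the conditional entropy takes over.\<close>
    have "(1 - \<delta>) * H \<le> cond_entropy_pmf V (key \<pi>) eve_view"
      using eq nonneg \<open>0 \<le> H\<close> by (cases "H = 0") (auto simp: pos_less_divide_eq less_imp_le)
    also have "\<dots> \<le> triple_cmi V +
        (entropy_pmf V (\<lambda>v. (key \<pi> v, key_estimate \<pi> v)) - entropy_pmf V (key_estimate \<pi>))"
      unfolding V_def by (rule key_equivocation_le[OF valid])
    also have "\<dots> \<le> real n * C + (- log 2 (1 - \<delta>) + \<delta> * (log 2 (K ^ n) - log 2 \<delta>))"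
    proof (intro add_mono)
      show "triple_cmi V \<le> real n * C"
        unfolding V_def n_def by (rule final_views_bounds(1)[OF C K valid])
      have "card (key \<pi> ` set_pmf V) \<le> card (set_pmf V)" using fin by (rule card_image_le)
      also have "\<dots> \<le> K ^ n" unfolding V_def n_def by (rule final_views_bounds(2)[OF C K valid])
      finally show "entropy_pmf V (\<lambda>v. (key \<pi> v, key_estimate \<pi> v)) - entropy_pmf V (key_estimate \<pi>) \<le>
          - log 2 (1 - \<delta>) + \<delta> * (log 2 (K ^ n) - log 2 \<delta>)"
        using fano_inequality[OF fin _ err \<delta>, of "K ^ n"] by simp
    qed
    also have "\<dots> = n * C + (- log 2 (1 - \<delta>) - \<delta> * log 2 \<delta>) + n * (\<delta> * log 2 K)"
      using Kpos by (simp add: log_nat_power algebra_simps)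
    \<comment> \<open>The terms free of \<open>n\<close> are nonnegative, so they may be multiplied
      by \<open>n\<close>; then \<open>n\<close> divides out.\<close>
    also have "\<dots> \<le> n * C + n * (- log 2 (1 - \<delta>) - \<delta> * log 2 \<delta>) + n * (\<delta> * log 2 K)"
    proof -
      have "log 2 (1 - \<delta>) \<le> 0" "\<delta> * log 2 \<delta> \<le> 0" using \<delta> by (simp_all add: mult_nonneg_nonpos)
      then have "1 * (- log 2 (1 - \<delta>) - \<delta> * log 2 \<delta>) \<le> n * (- log 2 (1 - \<delta>) - \<delta> * log 2 \<delta>)"
        using n by (intro mult_right_mono) auto
      then show ?thesis by simp
    qed
    also have "\<dots> = n * (C + \<phi> \<delta>)" by (simp add: \<phi>_def algebra_simps)
    finally have "(1 - \<delta>) * (H / n) \<le> C + \<phi> \<delta>"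
      using n by (simp add: pos_divide_le_eq mult.commute)
    moreover have "(1 - \<delta>) * (R - \<delta>) \<le> (1 - \<delta>) * (H / n)"
      using rate \<delta> by (intro mult_left_mono) auto
    ultimately show ?thesis by linarith
  qed
  \<comment> \<open>As \<open>\<delta>\<close> tends to 0 from the right, the left side tends to
    \<open>R\<close> and \<open>\<phi> \<delta>\<close> to 0.\<close>
  have "\<forall>\<^sub>F \<delta> in at_right 0. (1 - \<delta>) * (R - \<delta>) \<le> C + \<phi> \<delta>"
    by (rule eventually_mono[OF eventually_at_right_real[of 0 1]]) (auto intro: bound)
  moreover have "((\<lambda>\<delta>. (1 - \<delta>) * (R - \<delta>)) \<longlongrightarrow> R) (at_right 0)" by real_asymp
  moreover have "((\<lambda>\<delta>. C + \<phi> \<delta>) \<longlongrightarrow> C) (at_right 0)" unfolding \<phi>_def by real_asymp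
  ultimately show "R \<le> C" by (intro tendsto_le[of "at_right 0"]) auto
qed

theorem theorem2:
  fixes Wf :: "('xf :: finite, 'yf :: finite, 'zf :: finite) dmbc"
    and Wb :: "('xb :: finite, 'yb :: finite, 'zb :: finite) dmbc"
  shows "sk_capacity Wf Wb \<le>
           (SUP (P_Xf, P_Xb) \<in> UNIV. ereal (max (channel_cmi Wf P_Xf) (channel_cmi Wb P_Xb)))"
proof -
  \<comment> \<open>Separately optimal input laws supply the finite real bound that
    \<open>achievable_rate_le\<close> asks for, and their pair is among the indices of the
    supremum.\<close>
  obtain Pf where Pf: "\<And>Q. channel_cmi Wf Q \<le> channel_cmi Wf Pf"
    using channel_cmi_attains_max[of Wf] by auto
  obtain Pb where Pb: "\<And>Q. channel_cmi Wb Q \<le> channel_cmi Wb Pb"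
    using channel_cmi_attains_max[of Wb] by auto
  have "sk_capacity Wf Wb \<le> ereal (max (channel_cmi Wf Pf) (channel_cmi Wb Pb))"
    unfolding sk_capacity_def
  proof (rule SUP_least)
    fix R assume "R \<in> {R. achievable_rate Wf Wb R}"
    then have "R \<le> max (channel_cmi Wf Pf) (channel_cmi Wb Pb)"
      by (intro achievable_rate_le[OF max.coboundedI1[OF Pf] max.coboundedI2[OF Pb]]) simp
    then show "ereal R \<le> ereal (max (channel_cmi Wf Pf) (channel_cmi Wb Pb))"
      by (simp only: ereal_less_eq)
  qed
  also have "\<dots> \<le> (SUP (P_Xf, P_Xb) \<in> UNIV. ereal (max (channel_cmi Wf P_Xf) (channel_cmi Wb P_Xb)))"
    by (rule SUP_upper2[of "(Pf, Pb)"]) simp_all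
  finally show ?thesis .
qed

end
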